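(* Let $\mathcal{C}$ be an a.s.-compatibly representable Markov category with conditionals and let $p$ be a hidden Markov model in $\mathcal{C}$ with transition kernels $f_t\colon X_{t-1}\to X_t$ and observation kernels $g_t\colon X_t\to Y_t$, $t=0,\dots,n$. Then for all $t\in[n]$ the filter process $\mathrm{BFP}_t\colon I\to PX_0\otimes\cdots\otimes PX_t$ is the Markov chain with initial distribution $h_0$ and transition kernels $h_1,\dots,h_t$; that is, $$\mathrm{BFP}_t=M_t,$$ where $M_0:=h_0$ and $M_s:=\big(\mathrm{id}_{PX_0\otimes\cdots\otimes PX_{s-2}}\otimes((\mathrm{id}_{PX_{s-1}}\otimes h_s)\circ\mathrm{copy}_{PX_{s-1}})\big)\circ M_{s-1}$ for $1\le s\le t$.
   Context: A Markov category is a symmetric monoidal category whose monoidal unit $I$ is terminal, in which every object $X$ carries a distinguished commutative comonoid structure $\mathrm{copy}_X\colon X\to X\otimes X$, $\mathrm{del}_X\colon X\to I$, compatible with $\otimes$. Coherence isomorphisms and symmetries are suppressed. A morphism $f\colon A\to X$ is deterministic if $\mathrm{copy}_X\circ f=(f\otimes f)\circ\mathrm{copy}_A$. Conditionals: a conditional of $f\colon A\to X\otimes Y$ with respect to $Y$ is a morphism $f_{|Y}\colon A\otimes Y\to X$ such that $f$ equals the composite: copy $A$; apply to one copy the marginal $f_Y:=(\mathrm{del}_X\otimes\mathrm{id}_Y)\circ f$; copy the resulting $Y$; output one copy of $Y$ and apply $f_{|Y}$ to the other copy of $A$ and the other copy of $Y$ to produce $X$. $\mathcal{C}$ has conditionals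 if these always exist. Almost sure equality: for $q\colon W\to A$ and $a,b\colon A\to X$, $a=_{q\text{-a.s.}}b$ means $(\mathrm{id}_A\otimes a)\circ\mathrm{copy}_A\circ q=(\mathrm{id}_A\otimes b)\circ\mathrm{copy}_A\circ q$. Representability: $\mathcal{C}$ is representable if for every object $X$ there are an object $PX$ and a morphism $\mathsf{samp}_X\colon PX\to X$ such that every $f\colon A\to X$ factors as $f=\mathsf{samp}_X\circ f^\sharp$ for a unique deterministic $f^\sharp\colon A\to PX$ (the deterministic counterpart). It is a.s.-compatibly representable if moreover $a=_{q\text{-a.s.}}b$ implies $a^\sharp=_{q\text{-a.s.}}b^\sharp$ for all $q\colon W\to A$ and $a,b\colon A\to X$. Notation: $[t]=\{0,\dots,t\}$; $Y_{[t]}=Y_0\otimes\cdots\otimes Y_t$, $Y_{[-1]}=I$; conventions $X_{-1}=I$, $PX_{-1}=I$, $\mathrm{BF}_{-1}=\mathrm{id}_I$. Hidden Markov model: given $f_t\colon X_{t-1}\to X_t$ and $g_t\colon X_t\to Y_t$ ($t=0,\dots,n$), it is the state $p\colon I\to\bigotimes_{t\in[n]}(X_t\otimes Y_t)$, $p=\big(\bigotimes_{t=0}^n((\mathrm{id}_{X_t}\otimes g_t)\circ\mathrm{copy}_{X_t})\big)\circ m_n$, where $m_0=f_0$ and $m_t=\big(\mathrm{id}_{X_0\otimes\cdots\otimes X_{t-2}}\otimes((\mathrm{id}_{X_{t-1}}\otimes f_t)\circ\mathrm{copy}_{X_{t-1}})\big)\circ m_{t-1}$. Write $p^Y_{[t]}$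 for the marginal of $p$ on $Y_{[t]}$. Bayes filter: $\mathrm{BF}_t\colon Y_{[t]}\to X_t$ is a (choice of) conditional, with respect to $Y_{[t]}$, of the marginal of $p$ on $Y_{[t]}\otimes X_t$; it is unique up to $p^Y_{[t]}$-a.s. equality. $\mathrm{BF}_t^\sharp\colon Y_{[t]}\to PX_t$ is its deterministic counterpart. Update maps: $u_t\colon PX_{t-1}\otimes Y_t\to X_t$ is a (choice of) conditional with respect to $Y_t$ of $(\mathrm{id}_{X_t}\otimes g_t)\circ\mathrm{copy}_{X_t}\circ f_t\circ\mathsf{samp}_{X_{t-1}}\colon PX_{t-1}\to X_t\otimes Y_t$ (with $u_0=\mathrm{BF}_0$), and $u_t^\sharp$ is its deterministic counterpart. Transition maps: $h_t:=u_t^\sharp\circ\big(\mathrm{id}_{PX_{t-1}}\otimes(g_t\circ f_t\circ\mathsf{samp}_{X_{t-1}})\big)\circ\mathrm{copy}_{PX_{t-1}}\colon PX_{t-1}\to PX_t$ for $t\ge1$, and $h_0:=u_0^\sharp\circ g_0\circ f_0\colon I\to PX_0$. Filter process: define $\lambda_t\colon Y_{[t]}\to PX_0\otimes\cdots\otimes PX_t$ by $\lambda_0:=\mathrm{BF}_0^\sharp$ and $\lambda_t:=(\lambda_{t-1}\otimes\mathrm{BF}_t^\sharp)\circ(\mathrm{copy}_{Y_{[t-1]}}\otimes\mathrm{id}_{Y_t})$ for $t\ge1$. Then $\mathrm{BFP}_t:=\lambda_t\circ p^Y_{[t]}$. *)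

theory Defs
  imports Main
begin

section \<open>Categories\<close>

record ('o, 'm) cat =
  Obj :: "'o set"
  Arr :: "'m set"
  Dom :: "'m \<Rightarrow> 'o"
  Cod :: "'m \<Rightarrow> 'o"
  ide :: "'o \<Rightarrow> 'm"
  cmp :: "'m \<Rightarrow> 'm \<Rightarrow> 'm"  (infixr "\<cdot>\<index>" 55)

definition hom :: "('o, 'm, 'z) cat_scheme \<Rightarrow> 'o \<Rightarrow> 'o \<Rightarrow> 'm set" where
  "hom C A B = {f \<in> Arr C. Dom C f = A \<and> Cod C f = B}"

definition inverse_arrows :: "('o, 'm, 'z) cat_scheme \<Rightarrow> 'm \<Rightarrow> 'm \<Rightarrow> bool" where
  "inverse_arrows C f g \<longleftrightarrow>
     f \<in> Arr C \<and> g \<in> hom C (Cod C f) (Dom C f) \<and>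
     cmp C g f = ide C (Dom C f) \<and> cmp C f g = ide C (Cod C f)"

definition iso :: "('o, 'm, 'z) cat_scheme \<Rightarrow> 'm \<Rightarrow> bool" where
  "iso C f \<longleftrightarrow> (\<exists>g. inverse_arrows C f g)"

definition arr_inv :: "('o, 'm, 'z) cat_scheme \<Rightarrow> 'm \<Rightarrow> 'm" where
  "arr_inv C f = (THE g. inverse_arrows C f g)"

locale category =
  fixes C :: "('o, 'm, 'z) cat_scheme" (structure)
  assumes Dom_Obj: "f \<in> Arr C \<Longrightarrow> Dom C f \<in> Obj C"
    and Cod_Obj: "f \<in> Arr C \<Longrightarrow> Cod C f \<in> Obj C"
    and ide_hom: "A \<in> Obj C \<Longrightarrow> ide C A \<in> hom C A A"
    and cmp_hom: "\<lbrakk>f \<in> hom C A B; g \<in> hom C B D\<rbrakk> \<Longrightarrow> g \<cdot> f \<in> hom C A D"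
    and cmp_ide: "f \<in> hom C A B \<Longrightarrow> f \<cdot> ide C A = f"
    and ide_cmp: "f \<in> hom C A B \<Longrightarrow> ide C B \<cdot> f = f"
    and cmp_assoc: "\<lbrakk>f \<in> hom C A B; g \<in> hom C B D; h \<in> hom C D E\<rbrakk>
      \<Longrightarrow> (h \<cdot> g) \<cdot> f = h \<cdot> (g \<cdot> f)"


section \<open>Symmetric monoidal categories\<close>

text \<open>The categories are not assumed strict: all coherence isomorphisms are explicit.
  \<open>assoc A B D\<close> goes from \<open>(A \<boxtimes> B) \<boxtimes> D\<close> to \<open>A \<boxtimes> (B \<boxtimes> D)\<close>.
  The symbol \<open>\<boxtimes>\<close> is the tensor product of objects, \<open>\<otimes>\<close> that of morphisms.\<close>

record ('o, 'm) smcat = "('o, 'm) cat" +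
  tensO :: "'o \<Rightarrow> 'o \<Rightarrow> 'o"  (infix "\<boxtimes>\<index>" 70)
  tensM :: "'m \<Rightarrow> 'm \<Rightarrow> 'm"  (infix "\<otimes>\<index>" 70)
  unitO :: "'o"  ("\<I>\<index>")
  assoc :: "'o \<Rightarrow> 'o \<Rightarrow> 'o \<Rightarrow> 'm"
  lunit :: "'o \<Rightarrow> 'm"
  runit :: "'o \<Rightarrow> 'm"
  swap :: "'o \<Rightarrow> 'o \<Rightarrow> 'm"

locale symmetric_monoidal_category = category C
  for C :: "('o, 'm, 'z) smcat_scheme" (structure) +
  assumes unitO_Obj: "\<I> \<in> Obj C"
    and tensO_Obj: "\<lbrakk>A \<in> Obj C; B \<in> Obj C\<rbrakk> \<Longrightarrow> A \<boxtimes> B \<in> Obj C"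
    and tensM_hom: "\<lbrakk>f \<in> hom C A A'; g \<in> hom C B B'\<rbrakk> \<Longrightarrow> f \<otimes> g \<in> hom C (A \<boxtimes> B) (A' \<boxtimes> B')"
    and tensM_ide: "\<lbrakk>A \<in> Obj C; B \<in> Obj C\<rbrakk> \<Longrightarrow> ide C A \<otimes> ide C B = ide C (A \<boxtimes> B)"
    and tensM_cmp: "\<lbrakk>f \<in> hom C A A'; f' \<in> hom C A' A''; g \<in> hom C B B'; g' \<in> hom C B' B''\<rbrakk>
      \<Longrightarrow> (f' \<cdot> f) \<otimes> (g' \<cdot> g) = (f' \<otimes> g') \<cdot> (f \<otimes> g)"
    and assoc_hom: "\<lbrakk>A \<in> Obj C; B \<in> Obj C; D \<in> Obj C\<rbrakk>
      \<Longrightarrow> assoc C A B D \<in> hom C ((A \<boxtimes> B) \<boxtimes> D) (A \<boxtimes> (B \<boxtimes> D))"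
    and assoc_iso: "\<lbrakk>A \<in> Obj C; B \<in> Obj C; D \<in> Obj C\<rbrakk> \<Longrightarrow> iso C (assoc C A B D)"
    and assoc_natural: "\<lbrakk>f \<in> hom C A A'; g \<in> hom C B B'; h \<in> hom C D D'\<rbrakk>
      \<Longrightarrow> assoc C A' B' D' \<cdot> ((f \<otimes> g) \<otimes> h) = (f \<otimes> (g \<otimes> h)) \<cdot> assoc C A B D"
    and lunit_hom: "A \<in> Obj C \<Longrightarrow> lunit C A \<in> hom C (\<I> \<boxtimes> A) A"
    and lunit_iso: "A \<in> Obj C \<Longrightarrow> iso C (lunit C A)"
    and lunit_natural: "f \<in> hom C A A' \<Longrightarrow> lunit C A' \<cdot> (ide C \<I> \<otimes> f) = f \<cdot> lunit C A"
    and runit_hom: "A \<in> Obj C \<Longrightarrow> runit C A \<in> hom C (A \<boxtimes> \<I>) A"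
    and runit_iso: "A \<in> Obj C \<Longrightarrow> iso C (runit C A)"
    and runit_natural: "f \<in> hom C A A' \<Longrightarrow> runit C A' \<cdot> (f \<otimes> ide C \<I>) = f \<cdot> runit C A"
    and triangle: "\<lbrakk>A \<in> Obj C; B \<in> Obj C\<rbrakk>
      \<Longrightarrow> (ide C A \<otimes> lunit C B) \<cdot> assoc C A \<I> B = runit C A \<otimes> ide C B"
    and pentagon: "\<lbrakk>A \<in> Obj C; B \<in> Obj C; D \<in> Obj C; E \<in> Obj C\<rbrakk>
      \<Longrightarrow> assoc C A B (D \<boxtimes> E) \<cdot> assoc C (A \<boxtimes> B) D E =
          (ide C A \<otimes> assoc C B D E) \<cdot> assoc C A (B \<boxtimes> D) E \<cdot> (assoc C A B D \<otimes> ide C E)"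
    and swap_hom: "\<lbrakk>A \<in> Obj C; B \<in> Obj C\<rbrakk> \<Longrightarrow> swap C A B \<in> hom C (A \<boxtimes> B) (B \<boxtimes> A)"
    and swap_natural: "\<lbrakk>f \<in> hom C A A'; g \<in> hom C B B'\<rbrakk>
      \<Longrightarrow> swap C A' B' \<cdot> (f \<otimes> g) = (g \<otimes> f) \<cdot> swap C A B"
    and swap_swap: "\<lbrakk>A \<in> Obj C; B \<in> Obj C\<rbrakk> \<Longrightarrow> swap C B A \<cdot> swap C A B = ide C (A \<boxtimes> B)"
    and hexagon: "\<lbrakk>A \<in> Obj C; B \<in> Obj C; D \<in> Obj C\<rbrakk>
      \<Longrightarrow> assoc C B D A \<cdot> swap C A (B \<boxtimes> D) \<cdot> assoc C A B D =
          (ide C B \<otimes> swap C A D) \<cdot> assoc C B A D \<cdot> (swap C A B \<otimes> ide C D)"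

definition middle_swap :: "('o, 'm, 'z) smcat_scheme \<Rightarrow> 'o \<Rightarrow> 'o \<Rightarrow> 'm" where
  \<comment> \<open>\<open>(A \<boxtimes> A) \<boxtimes> (B \<boxtimes> B) \<rightarrow> (A \<boxtimes> B) \<boxtimes> (A \<boxtimes> B)\<close>, swapping the two inner factors\<close>
  "middle_swap C A B =
     arr_inv C (assoc C A B (A \<boxtimes>\<^bsub>C\<^esub> B))
     \<cdot>\<^bsub>C\<^esub> (ide C A \<otimes>\<^bsub>C\<^esub> (assoc C B A B \<cdot>\<^bsub>C\<^esub> (swap C A B \<otimes>\<^bsub>C\<^esub> ide C B) \<cdot>\<^bsub>C\<^esub> arr_inv C (assoc C A B B)))
     \<cdot>\<^bsub>C\<^esub> assoc C A A (B \<boxtimes>\<^bsub>C\<^esub> B)"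


section \<open>Markov categories\<close>

record ('o, 'm) mcat = "('o, 'm) smcat" +
  copy :: "'o \<Rightarrow> 'm"
  del :: "'o \<Rightarrow> 'm"

locale markov_category = symmetric_monoidal_category C
  for C :: "('o, 'm, 'z) mcat_scheme" (structure) +
  assumes unit_terminal: "A \<in> Obj C \<Longrightarrow> \<exists>!f. f \<in> hom C A \<I>"
    and copy_hom: "A \<in> Obj C \<Longrightarrow> copy C A \<in> hom C A (A \<boxtimes> A)"
    and del_hom: "A \<in> Obj C \<Longrightarrow> del C A \<in> hom C A \<I>"
    and copy_coassoc: "A \<in> Obj C
      \<Longrightarrow> assoc C A A A \<cdot> (copy C A \<otimes> ide C A) \<cdot> copy C A = (ide C A \<otimes> copy C A) \<cdot> copy C A"
    and copy_counit_left: "A \<in> Obj C \<Longrightarrow> lunit C A \<cdot> (del C A \<otimes> ide C A) \<cdot> copy C A = ide C A"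
    and copy_counit_right: "A \<in> Obj C \<Longrightarrow> runit C A \<cdot> (ide C A \<otimes> del C A) \<cdot> copy C A = ide C A"
    and copy_commutative: "A \<in> Obj C \<Longrightarrow> swap C A A \<cdot> copy C A = copy C A"
    and copy_tensor: "\<lbrakk>A \<in> Obj C; B \<in> Obj C\<rbrakk>
      \<Longrightarrow> copy C (A \<boxtimes> B) = middle_swap C A B \<cdot> (copy C A \<otimes> copy C B)"
    and del_tensor: "\<lbrakk>A \<in> Obj C; B \<in> Obj C\<rbrakk>
      \<Longrightarrow> del C (A \<boxtimes> B) = lunit C \<I> \<cdot> (del C A \<otimes> del C B)"
    and copy_unit: "copy C \<I> = arr_inv C (lunit C \<I>)"
    and del_unit: "del C \<I> = ide C \<I>"

context
  fixes C :: "('o, 'm, 'z) mcat_scheme" (structure)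
begin

definition deterministic :: "'m \<Rightarrow> bool" where
  "deterministic f \<longleftrightarrow> f \<in> Arr C \<and> copy C (Cod C f) \<cdot> f = (f \<otimes> f) \<cdot> copy C (Dom C f)"

definition snd_proj :: "'o \<Rightarrow> 'o \<Rightarrow> 'm" where
  \<comment> \<open>\<open>X \<boxtimes> Y \<rightarrow> Y\<close>\<close>
  "snd_proj X Y = lunit C Y \<cdot> (del C X \<otimes> ide C Y)"

definition fst_proj :: "'o \<Rightarrow> 'o \<Rightarrow> 'm" where
  \<comment> \<open>\<open>X \<boxtimes> Y \<rightarrow> X\<close>\<close>
  "fst_proj X Y = runit C X \<cdot> (ide C X \<otimes> del C Y)"

text \<open>\<open>k\<close> is a conditional of \<open>f : A \<rightarrow> X \<boxtimes> Y\<close> with respect to \<open>Y\<close>.\<close>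

definition conditional :: "'o \<Rightarrow> 'o \<Rightarrow> 'o \<Rightarrow> 'm \<Rightarrow> 'm \<Rightarrow> bool" where
  "conditional A X Y f k \<longleftrightarrow>
     f \<in> hom C A (X \<boxtimes> Y) \<and> k \<in> hom C (A \<boxtimes> Y) X \<and>
     f = (k \<otimes> ide C Y)
         \<cdot> arr_inv C (assoc C A Y Y)
         \<cdot> (ide C A \<otimes> copy C Y)
         \<cdot> (ide C A \<otimes> (snd_proj X Y \<cdot> f))
         \<cdot> copy C A"

definition has_conditionals :: bool where
  "has_conditionals \<longleftrightarrow>
     (\<forall>A\<in>Obj C. \<forall>X\<in>Obj C. \<forall>Y\<in>Obj C. \<forall>f\<in>hom C A (X \<boxtimes> Y). \<exists>k. conditional A X Y f k)"

definition as_equal :: "'m \<Rightarrow> 'm \<Rightarrow> 'm \<Rightarrow> bool" where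
  \<comment> \<open>meant for \<open>q : W \<rightarrow> A\<close> and \<open>a, b : A \<rightarrow> X\<close>\<close>
  "as_equal q a b \<longleftrightarrow>
     (ide C (Cod C q) \<otimes> a) \<cdot> copy C (Cod C q) \<cdot> q =
     (ide C (Cod C q) \<otimes> b) \<cdot> copy C (Cod C q) \<cdot> q"

text \<open>Representability is stated relative to a choice of the objects \<open>P X\<close> and the
  morphisms \<open>samp X\<close>.\<close>

definition representable_by :: "('o \<Rightarrow> 'o) \<Rightarrow> ('o \<Rightarrow> 'm) \<Rightarrow> bool" where
  "representable_by P samp \<longleftrightarrow>
     (\<forall>X\<in>Obj C. P X \<in> Obj C \<and> samp X \<in> hom C (P X) X \<and>
        (\<forall>A\<in>Obj C. \<forall>f\<in>hom C A X.
           \<exists>!k. k \<in> hom C A (P X) \<and> deterministic k \<and> f = samp X \<cdot> k))"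

definition sharp :: "('o \<Rightarrow> 'o) \<Rightarrow> ('o \<Rightarrow> 'm) \<Rightarrow> 'm \<Rightarrow> 'm" where
  "sharp P samp f =
     (THE k. k \<in> hom C (Dom C f) (P (Cod C f)) \<and> deterministic k \<and> f = samp (Cod C f) \<cdot> k)"

definition as_compatibly_representable_by :: "('o \<Rightarrow> 'o) \<Rightarrow> ('o \<Rightarrow> 'm) \<Rightarrow> bool" where
  "as_compatibly_representable_by P samp \<longleftrightarrow>
     representable_by P samp \<and>
     (\<forall>W\<in>Obj C. \<forall>A\<in>Obj C. \<forall>X\<in>Obj C. \<forall>q\<in>hom C W A. \<forall>a\<in>hom C A X. \<forall>b\<in>hom C A X.
        as_equal q a b \<longrightarrow> as_equal q (sharp P samp a) (sharp P samp b))"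


section \<open>Iterated tensor products and Markov chains\<close>

text \<open>Iterated tensor products over \<open>0, \<dots>, t\<close> are bracketed to the left.\<close>

primrec tensO_upto :: "(nat \<Rightarrow> 'o) \<Rightarrow> nat \<Rightarrow> 'o" where
  "tensO_upto Z 0 = Z 0"
| "tensO_upto Z (Suc t) = tensO_upto Z t \<boxtimes> Z (Suc t)"

primrec tensM_upto :: "(nat \<Rightarrow> 'm) \<Rightarrow> nat \<Rightarrow> 'm" where
  "tensM_upto k 0 = k 0"
| "tensM_upto k (Suc t) = tensM_upto k t \<otimes> k (Suc t)"

text \<open>Marginalization from \<open>Z 0, \<dots>, Z n\<close> to \<open>Z 0, \<dots>, Z t\<close>, for \<open>t \<le> n\<close>.\<close>

primrec initial_proj :: "(nat \<Rightarrow> 'o) \<Rightarrow> nat \<Rightarrow> nat \<Rightarrow> 'm" where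
  "initial_proj Z t 0 = ide C (Z 0)"
| "initial_proj Z t (Suc n) =
     (if t \<le> n then initial_proj Z t n \<cdot> fst_proj (tensO_upto Z n) (Z (Suc n))
      else ide C (tensO_upto Z (Suc n)))"

text \<open>Given \<open>h : Z t \<rightarrow> Z (Suc t)\<close>, the morphism from \<open>tensO_upto Z t\<close> to
  \<open>tensO_upto Z (Suc t)\<close> which copies the last factor and applies \<open>h\<close> to one copy.\<close>

definition chain_step :: "(nat \<Rightarrow> 'o) \<Rightarrow> nat \<Rightarrow> 'm \<Rightarrow> 'm" where
  "chain_step Z t h =
     (case t of
        0 \<Rightarrow> (ide C (Z 0) \<otimes> h) \<cdot> copy C (Z 0)
      | Suc r \<Rightarrow> arr_inv C (assoc C (tensO_upto Z r) (Z t) (Z (Suc t)))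
                 \<cdot> (ide C (tensO_upto Z r) \<otimes> ((ide C (Z t) \<otimes> h) \<cdot> copy C (Z t))))"

text \<open>The Markov chain with initial distribution \<open>k 0 : \<I> \<rightarrow> Z 0\<close> and
  transition kernels \<open>k (Suc t) : Z t \<rightarrow> Z (Suc t)\<close>.\<close>

primrec markov_chain :: "(nat \<Rightarrow> 'o) \<Rightarrow> (nat \<Rightarrow> 'm) \<Rightarrow> nat \<Rightarrow> 'm" where
  "markov_chain Z k 0 = k 0"
| "markov_chain Z k (Suc t) = chain_step Z t (k (Suc t)) \<cdot> markov_chain Z k t"


section \<open>Hidden Markov models and their Bayes filters\<close>

definition hmm_kernels ::
  "(nat \<Rightarrow> 'o) \<Rightarrow> (nat \<Rightarrow> 'o) \<Rightarrow> (nat \<Rightarrow> 'm) \<Rightarrow> (nat \<Rightarrow> 'm) \<Rightarrow> nat \<Rightarrow> bool" where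
  "hmm_kernels X Y f g n \<longleftrightarrow>
     (\<forall>t\<le>n. X t \<in> Obj C \<and> Y t \<in> Obj C \<and>
        f t \<in> hom C (case t of 0 \<Rightarrow> \<I> | Suc s \<Rightarrow> X s) (X t) \<and>
        g t \<in> hom C (X t) (Y t))"

definition hmm ::
  "(nat \<Rightarrow> 'o) \<Rightarrow> (nat \<Rightarrow> 'm) \<Rightarrow> (nat \<Rightarrow> 'm) \<Rightarrow> nat \<Rightarrow> 'm" where
  "hmm X f g n =
     tensM_upto (\<lambda>t. (ide C (X t) \<otimes> g t) \<cdot> copy C (X t)) n \<cdot> markov_chain X f n"

definition obs_proj :: "(nat \<Rightarrow> 'o) \<Rightarrow> (nat \<Rightarrow> 'o) \<Rightarrow> nat \<Rightarrow> 'm" where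
  \<comment> \<open>\<open>(X 0 \<boxtimes> Y 0) \<boxtimes> \<dots> \<boxtimes> (X t \<boxtimes> Y t) \<rightarrow> Y 0 \<boxtimes> \<dots> \<boxtimes> Y t\<close>\<close>
  "obs_proj X Y t = tensM_upto (\<lambda>s. snd_proj (X s) (Y s)) t"

definition state_obs_proj :: "(nat \<Rightarrow> 'o) \<Rightarrow> (nat \<Rightarrow> 'o) \<Rightarrow> nat \<Rightarrow> 'm" where
  \<comment> \<open>\<open>(X 0 \<boxtimes> Y 0) \<boxtimes> \<dots> \<boxtimes> (X t \<boxtimes> Y t) \<rightarrow> X t \<boxtimes> (Y 0 \<boxtimes> \<dots> \<boxtimes> Y t)\<close>\<close>
  "state_obs_proj X Y t =
     (case t of
        0 \<Rightarrow> ide C (X 0 \<boxtimes> Y 0)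
      | Suc r \<Rightarrow> assoc C (X t) (tensO_upto Y r) (Y t)
                 \<cdot> (swap C (tensO_upto Y r) (X t) \<otimes> ide C (Y t))
                 \<cdot> arr_inv C (assoc C (tensO_upto Y r) (X t) (Y t))
                 \<cdot> (obs_proj X Y r \<otimes> ide C (X t \<boxtimes> Y t)))"

definition obs_marginal ::
  "(nat \<Rightarrow> 'o) \<Rightarrow> (nat \<Rightarrow> 'o) \<Rightarrow> 'm \<Rightarrow> nat \<Rightarrow> nat \<Rightarrow> 'm" where
  "obs_marginal X Y p n t =
     obs_proj X Y t \<cdot> initial_proj (\<lambda>s. X s \<boxtimes> Y s) t n \<cdot> p"

definition state_obs_marginal ::
  "(nat \<Rightarrow> 'o) \<Rightarrow> (nat \<Rightarrow> 'o) \<Rightarrow> 'm \<Rightarrow> nat \<Rightarrow> nat \<Rightarrow> 'm" where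
  "state_obs_marginal X Y p n t =
     state_obs_proj X Y t \<cdot> initial_proj (\<lambda>s. X s \<boxtimes> Y s) t n \<cdot> p"

text \<open>A conditional of a state has domain \<open>\<I> \<boxtimes> \<dots>\<close>; the unitor removes the unit factor.\<close>

definition bayes_filter ::
  "(nat \<Rightarrow> 'o) \<Rightarrow> (nat \<Rightarrow> 'o) \<Rightarrow> 'm \<Rightarrow> nat \<Rightarrow> nat \<Rightarrow> 'm \<Rightarrow> bool" where
  "bayes_filter X Y p n t b \<longleftrightarrow>
     b \<in> hom C (tensO_upto Y t) (X t) \<and>
     conditional \<I> (X t) (tensO_upto Y t) (state_obs_marginal X Y p n t)
       (b \<cdot> lunit C (tensO_upto Y t))"

definition bayes_filters ::
  "(nat \<Rightarrow> 'o) \<Rightarrow> (nat \<Rightarrow> 'o) \<Rightarrow> 'm \<Rightarrow> nat \<Rightarrow> (nat \<Rightarrow> 'm) \<Rightarrow> bool" where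
  "bayes_filters X Y p n BF \<longleftrightarrow> (\<forall>t\<le>n. bayes_filter X Y p n t (BF t))"

definition update_maps ::
  "('o \<Rightarrow> 'o) \<Rightarrow> ('o \<Rightarrow> 'm) \<Rightarrow> (nat \<Rightarrow> 'o) \<Rightarrow> (nat \<Rightarrow> 'o) \<Rightarrow> (nat \<Rightarrow> 'm) \<Rightarrow> (nat \<Rightarrow> 'm) \<Rightarrow> nat
   \<Rightarrow> (nat \<Rightarrow> 'm) \<Rightarrow> (nat \<Rightarrow> 'm) \<Rightarrow> bool" where
  "update_maps P samp X Y f g n BF u \<longleftrightarrow>
     u 0 = BF 0 \<and>
     (\<forall>t<n. conditional (P (X t)) (X (Suc t)) (Y (Suc t))
        ((ide C (X (Suc t)) \<otimes> g (Suc t)) \<cdot> copy C (X (Suc t)) \<cdot> f (Suc t) \<cdot> samp (X t))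
        (u (Suc t)))"

primrec transition ::
  "('o \<Rightarrow> 'o) \<Rightarrow> ('o \<Rightarrow> 'm) \<Rightarrow> (nat \<Rightarrow> 'o) \<Rightarrow> (nat \<Rightarrow> 'm) \<Rightarrow> (nat \<Rightarrow> 'm) \<Rightarrow> (nat \<Rightarrow> 'm)
   \<Rightarrow> nat \<Rightarrow> 'm" where
  "transition P samp X f g u 0 = sharp P samp (u 0) \<cdot> g 0 \<cdot> f 0"
| "transition P samp X f g u (Suc t) =
     sharp P samp (u (Suc t))
     \<cdot> (ide C (P (X t)) \<otimes> (g (Suc t) \<cdot> f (Suc t) \<cdot> samp (X t)))
     \<cdot> copy C (P (X t))"

primrec filter_kernel ::
  "('o \<Rightarrow> 'o) \<Rightarrow> ('o \<Rightarrow> 'm) \<Rightarrow> (nat \<Rightarrow> 'o) \<Rightarrow> (nat \<Rightarrow> 'm) \<Rightarrow> nat \<Rightarrow> 'm" where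
  "filter_kernel P samp Y BF 0 = sharp P samp (BF 0)"
| "filter_kernel P samp Y BF (Suc t) =
     (filter_kernel P samp Y BF t \<otimes> sharp P samp (BF (Suc t)))
     \<cdot> assoc C (tensO_upto Y t) (tensO_upto Y t) (Y (Suc t))
     \<cdot> (copy C (tensO_upto Y t) \<otimes> ide C (Y (Suc t)))"

definition filter_process ::
  "('o \<Rightarrow> 'o) \<Rightarrow> ('o \<Rightarrow> 'm) \<Rightarrow> (nat \<Rightarrow> 'o) \<Rightarrow> (nat \<Rightarrow> 'o) \<Rightarrow> 'm \<Rightarrow> nat \<Rightarrow> (nat \<Rightarrow> 'm)
   \<Rightarrow> nat \<Rightarrow> 'm" where
  "filter_process P samp X Y p n BF t = filter_kernel P samp Y BF t \<cdot> obs_marginal X Y p n t"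

end

end

theory Submission
  imports Defs
begin

text \<open>
  Write \<open>\<langle>a, b\<rangle> = (a \<otimes> b) \<cdot> copy\<close>. Deterministic morphisms commute with this pairing, every structural
  isomorphism acts on pairs in the evident way, and \<open>\<langle>fst, snd\<rangle> = id\<close>; hence coherence reduces to
  rewriting of pairs. Let \<open>r\<^sub>t\<close> be the law of the observations up to time \<open>t\<close> and
  \<open>d = BF\<^sub>t\<^sup>\<sharp>\<close>. As \<open>d\<close> is deterministic, it may be copied past the conditional that defines
  \<open>u\<^sub>t\<^sub>+\<^sub>1\<close>, and so \<open>BF\<^sub>t\<^sub>+\<^sub>1\<close> and \<open>u\<^sub>t\<^sub>+\<^sub>1 \<cdot> (d \<otimes> id)\<close> are almost surely equal with respect to
  \<open>r\<^sub>t\<^sub>+\<^sub>1\<close>. By a.s.-compatibility their deterministic counterparts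
  \<open>BF\<^sub>t\<^sub>+\<^sub>1\<^sup>\<sharp>\<close> and \<open>u\<^sub>t\<^sub>+\<^sub>1\<^sup>\<sharp> \<cdot> (d \<otimes> id)\<close> are almost surely equal too. Since
  \<open>r\<^sub>t\<^sub>+\<^sub>1 = \<langle>id, g \<cdot> f \<cdot> samp \<cdot> d\<rangle> \<cdot> r\<^sub>t\<close>, appending \<open>BF\<^sub>t\<^sub>+\<^sub>1\<^sup>\<sharp>\<close> to the filter process amounts to one step
  of the chain with kernel \<open>h\<^sub>t\<^sub>+\<^sub>1\<close>.
\<close>

section \<open>Categories and symmetric monoidal categories\<close>

context category
begin

lemma homD:
  assumes "f \<in> hom C A B"
  shows "f \<in> Arr C" "Dom C f = A" "Cod C f = B" "A \<in> Obj C" "B \<in> Obj C"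
  using assms Dom_Obj Cod_Obj by (auto simp: hom_def)

lemma homI: "\<lbrakk>f \<in> Arr C; Dom C f = A; Cod C f = B\<rbrakk> \<Longrightarrow> f \<in> hom C A B"
  by (simp add: hom_def)

lemmas [simp] = Dom_Obj Cod_Obj

lemma ide_simps [simp]:
  assumes "A \<in> Obj C"
  shows "ide C A \<in> Arr C" "Dom C (ide C A) = A" "Cod C (ide C A) = A"
  using homD[OF ide_hom[OF assms]] by auto

lemma cmp_simps [simp]:
  assumes "f \<in> Arr C" "g \<in> Arr C" "Dom C g = Cod C f"
  shows "g \<cdot> f \<in> Arr C" "Dom C (g \<cdot> f) = Dom C f" "Cod C (g \<cdot> f) = Cod C g"
  using cmp_hom[of f "Dom C f" "Cod C f" g "Cod C g"] assms by (auto simp: hom_def)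

lemma cmp_ide_Dom [simp]: "\<lbrakk>f \<in> Arr C; Dom C f = A\<rbrakk> \<Longrightarrow> f \<cdot> ide C A = f"
  using cmp_ide[of f A] by (auto simp: hom_def)

lemma ide_Cod_cmp [simp]: "\<lbrakk>f \<in> Arr C; Cod C f = A\<rbrakk> \<Longrightarrow> ide C A \<cdot> f = f"
  using ide_cmp[of f _ A] by (auto simp: hom_def)

text \<open>Orients composites to the right. The typing premises are equations on \<open>Dom\<close>
  and \<open>Cod\<close> rather than memberships in \<open>hom\<close>, so the simplifier need not
  guess intermediate objects.\<close>

lemma cmp_assoc_right [simp]:
  assumes "f \<in> Arr C" "g \<in> Arr C" "h \<in> Arr C" "Dom C g = Cod C f" "Dom C h = Cod C g"
  shows "(h \<cdot> g) \<cdot> f = h \<cdot> (g \<cdot> f)"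
  using cmp_assoc assms by (auto simp: hom_def)

lemma inverse_arrows_unique:
  assumes "inverse_arrows C f g" "inverse_arrows C f g'"
  shows "g = g'"
proof -
  have *: "f \<in> Arr C" "g \<in> Arr C" "Dom C g = Cod C f" "Cod C g = Dom C f" "g \<cdot> f = ide C (Dom C f)"
    "f \<cdot> g = ide C (Cod C f)"
    "g' \<in> Arr C" "Dom C g' = Cod C f" "Cod C g' = Dom C f" "f \<cdot> g' = ide C (Cod C f)"
    using assms by (auto simp: inverse_arrows_def hom_def)
  then have "g = g \<cdot> (f \<cdot> g')"
    by simp
  also have "\<dots> = (g \<cdot> f) \<cdot> g'"
    using *(1-4,7-9) by simp
  also have "\<dots> = g'"
    using * by simp
  finally show ?thesis .
qed

lemma arr_inv_eqI: "inverse_arrows C f g \<Longrightarrow> arr_inv C f = g"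
  unfolding arr_inv_def by (blast intro: inverse_arrows_unique)

lemma inverse_arrows_arr_inv: "iso C f \<Longrightarrow> inverse_arrows C f (arr_inv C f)"
  unfolding iso_def using arr_inv_eqI by metis

lemma arr_inv_simps:
  assumes "iso C f"
  shows "arr_inv C f \<in> Arr C" "Dom C (arr_inv C f) = Cod C f" "Cod C (arr_inv C f) = Dom C f"
    "arr_inv C f \<cdot> f = ide C (Dom C f)" "f \<cdot> arr_inv C f = ide C (Cod C f)"
  using inverse_arrows_arr_inv[OF assms] by (auto simp: inverse_arrows_def hom_def)

lemma iso_arr: "iso C f \<Longrightarrow> f \<in> Arr C"
  by (auto simp: iso_def inverse_arrows_def)

lemma arr_inv_cancel:
  assumes "iso C f" "g \<in> Arr C" "Cod C g = Dom C f"
  shows "arr_inv C f \<cdot> (f \<cdot> g) = g"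
  using cmp_assoc_right[of g f "arr_inv C f"] arr_inv_simps[OF assms(1)] iso_arr[OF assms(1)] assms(2-3)
  by simp

lemma iso_cancel_left:
  assumes "iso C f" "g \<in> Arr C" "h \<in> Arr C" "Cod C g = Dom C f" "Cod C h = Dom C f"
    and "f \<cdot> g = f \<cdot> h"
  shows "g = h"
  using arr_inv_cancel assms by metis

text \<open>Transfers naturality and pairing rules from an associator to its inverse.\<close>

lemma arr_inv_move:
  assumes "iso C f" "g \<in> Arr C" "Cod C g = Dom C f" "f \<cdot> g = h"
  shows "arr_inv C f \<cdot> h = g"
  using arr_inv_cancel assms by blast

end

section \<open>Interchange, and naturality of associators and swaps\<close>

context symmetric_monoidal_category
begin

lemmas [simp] = unitO_Obj tensO_Obj tensM_ide

lemma tensM_simps [simp]: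
  assumes "f \<in> Arr C" "g \<in> Arr C"
  shows "f \<otimes> g \<in> Arr C" "Dom C (f \<otimes> g) = Dom C f \<boxtimes> Dom C g" "Cod C (f \<otimes> g) = Cod C f \<boxtimes> Cod C g"
  using tensM_hom[of f "Dom C f" "Cod C f" g "Dom C g" "Cod C g"] assms by (auto simp: hom_def)

lemma interchange [simp]:
  assumes "f \<in> Arr C" "g \<in> Arr C" "f' \<in> Arr C" "g' \<in> Arr C" "Dom C f' = Cod C f" "Dom C g' = Cod C g"
  shows "(f' \<otimes> g') \<cdot> (f \<otimes> g) = (f' \<cdot> f) \<otimes> (g' \<cdot> g)"
  using tensM_cmp assms by (auto simp: hom_def)

text \<open>Composites are nested to the right, so \<open>interchange\<close> alone does not match
  when a further arrow \<open>k\<close> is applied before the two tensors.\<close>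

lemma interchange_cmp [simp]:
  assumes "f \<in> Arr C" "g \<in> Arr C" "f' \<in> Arr C" "g' \<in> Arr C" "Dom C f' = Cod C f" "Dom C g' = Cod C g"
    and "k \<in> Arr C" "Cod C k = Dom C f \<boxtimes> Dom C g"
  shows "(f' \<otimes> g') \<cdot> ((f \<otimes> g) \<cdot> k) = ((f' \<cdot> f) \<otimes> (g' \<cdot> g)) \<cdot> k"
  using cmp_assoc_right[of k "f \<otimes> g" "f' \<otimes> g'"] assms by simp

lemma assoc_simps [simp]:
  assumes "A \<in> Obj C" "B \<in> Obj C" "D \<in> Obj C"
  shows "assoc C A B D \<in> Arr C" "Dom C (assoc C A B D) = (A \<boxtimes> B) \<boxtimes> D"
    "Cod C (assoc C A B D) = A \<boxtimes> (B \<boxtimes> D)"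
    "arr_inv C (assoc C A B D) \<in> Arr C" "Dom C (arr_inv C (assoc C A B D)) = A \<boxtimes> (B \<boxtimes> D)"
    "Cod C (arr_inv C (assoc C A B D)) = (A \<boxtimes> B) \<boxtimes> D"
    "assoc C A B D \<cdot> arr_inv C (assoc C A B D) = ide C (A \<boxtimes> (B \<boxtimes> D))"
    "arr_inv C (assoc C A B D) \<cdot> assoc C A B D = ide C ((A \<boxtimes> B) \<boxtimes> D)"
  by (auto simp: homD[OF assoc_hom[OF assms]] arr_inv_simps[OF assoc_iso[OF assms]])

lemma unit_simps [simp]:
  assumes "A \<in> Obj C"
  shows "lunit C A \<in> Arr C" "Dom C (lunit C A) = \<I> \<boxtimes> A" "Cod C (lunit C A) = A"
    "runit C A \<in> Arr C" "Dom C (runit C A) = A \<boxtimes> \<I>" "Cod C (runit C A) = A"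
  using homD[OF lunit_hom[OF assms]] homD[OF runit_hom[OF assms]] by auto

lemma swap_simps [simp]:
  assumes "A \<in> Obj C" "B \<in> Obj C"
  shows "swap C A B \<in> Arr C" "Dom C (swap C A B) = A \<boxtimes> B" "Cod C (swap C A B) = B \<boxtimes> A"
  using homD[OF swap_hom[OF assms]] by auto

lemma assoc_nat:
  assumes "f \<in> Arr C" "g \<in> Arr C" "h \<in> Arr C" "Cod C f = A" "Cod C g = B" "Cod C h = D"
  shows "assoc C A B D \<cdot> ((f \<otimes> g) \<otimes> h) = (f \<otimes> (g \<otimes> h)) \<cdot> assoc C (Dom C f) (Dom C g) (Dom C h)"
  using assoc_natural assms by (auto simp: hom_def)

lemma assoc_inv_nat:
  assumes "f \<in> Arr C" "g \<in> Arr C" "h \<in> Arr C" "Cod C f = A" "Cod C g = B" "Cod C h = D"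
  shows "arr_inv C (assoc C A B D) \<cdot> (f \<otimes> (g \<otimes> h)) =
    ((f \<otimes> g) \<otimes> h) \<cdot> arr_inv C (assoc C (Dom C f) (Dom C g) (Dom C h))"
proof (rule arr_inv_move)
  let ?a = "assoc C (Dom C f) (Dom C g) (Dom C h)"
  have "assoc C A B D \<cdot> (((f \<otimes> g) \<otimes> h) \<cdot> arr_inv C ?a) = (assoc C A B D \<cdot> ((f \<otimes> g) \<otimes> h)) \<cdot> arr_inv C ?a"
    using assms by (subst cmp_assoc_right) auto
  also have "\<dots> = f \<otimes> (g \<otimes> h)"
    using assms by (subst assoc_nat) auto
  finally show "assoc C A B D \<cdot> (((f \<otimes> g) \<otimes> h) \<cdot> arr_inv C ?a) = f \<otimes> (g \<otimes> h)" .
qed (use assms assoc_iso in auto)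

lemma swap_nat:
  assumes "f \<in> Arr C" "g \<in> Arr C" "Cod C f = A" "Cod C g = B"
  shows "swap C A B \<cdot> (f \<otimes> g) = (g \<otimes> f) \<cdot> swap C (Dom C f) (Dom C g)"
  using swap_natural assms by (auto simp: hom_def)

text \<open>Isolated because it occurs twice: inside the middle swap, and in
  \<open>state_obs_proj\<close>, where it pulls the current state in front of the past
  observations.\<close>

definition inner_swap :: "'o \<Rightarrow> 'o \<Rightarrow> 'o \<Rightarrow> 'm" where
  "inner_swap B D E = assoc C D B E \<cdot> (swap C B D \<otimes> ide C E) \<cdot> arr_inv C (assoc C B D E)"

text \<open>The middle swap with four independent objects. Naturality needs this generality, since
  its four arguments may change their objects separately.\<close>

definition middle_swap4 :: "'o \<Rightarrow> 'o \<Rightarrow> 'o \<Rightarrow> 'o \<Rightarrow> 'm" where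
  "middle_swap4 A B D E =
     arr_inv C (assoc C A D (B \<boxtimes> E)) \<cdot> (ide C A \<otimes> inner_swap B D E) \<cdot> assoc C A B (D \<boxtimes> E)"

lemma middle_swap_eq: "middle_swap C A B = middle_swap4 A A B B"
  by (simp add: middle_swap_def middle_swap4_def inner_swap_def)

lemma inner_swap_simps [simp]:
  assumes "B \<in> Obj C" "D \<in> Obj C" "E \<in> Obj C"
  shows "inner_swap B D E \<in> Arr C" "Dom C (inner_swap B D E) = B \<boxtimes> (D \<boxtimes> E)"
    "Cod C (inner_swap B D E) = D \<boxtimes> (B \<boxtimes> E)"
  using assms by (auto simp: inner_swap_def)

lemma middle_swap4_simps [simp]:
  assumes "A \<in> Obj C" "B \<in> Obj C" "D \<in> Obj C" "E \<in> Obj C"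
  shows "middle_swap4 A B D E \<in> Arr C" "Dom C (middle_swap4 A B D E) = (A \<boxtimes> B) \<boxtimes> (D \<boxtimes> E)"
    "Cod C (middle_swap4 A B D E) = (A \<boxtimes> D) \<boxtimes> (B \<boxtimes> E)"
  using assms by (auto simp: middle_swap4_def)

lemma inner_swap_nat:
  assumes "b \<in> Arr C" "d \<in> Arr C" "e \<in> Arr C"
  shows "inner_swap (Cod C b) (Cod C d) (Cod C e) \<cdot> (b \<otimes> (d \<otimes> e)) =
    (d \<otimes> (b \<otimes> e)) \<cdot> inner_swap (Dom C b) (Dom C d) (Dom C e)"
proof -
  have "inner_swap (Cod C b) (Cod C d) (Cod C e) \<cdot> (b \<otimes> (d \<otimes> e)) =
    assoc C (Cod C d) (Cod C b) (Cod C e) \<cdot> (((d \<otimes> b) \<cdot> swap C (Dom C b) (Dom C d)) \<otimes> e)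
     \<cdot> arr_inv C (assoc C (Dom C b) (Dom C d) (Dom C e))"
    using assms by (simp add: inner_swap_def assoc_inv_nat swap_nat)
  also have "\<dots> = (assoc C (Cod C d) (Cod C b) (Cod C e) \<cdot> ((d \<otimes> b) \<otimes> e)) \<cdot>
    (swap C (Dom C b) (Dom C d) \<otimes> ide C (Dom C e)) \<cdot> arr_inv C (assoc C (Dom C b) (Dom C d) (Dom C e))"
    using assms by simp
  also have "\<dots> = (d \<otimes> (b \<otimes> e)) \<cdot> inner_swap (Dom C b) (Dom C d) (Dom C e)"
    using assms by (subst assoc_nat) (simp_all add: inner_swap_def)
  finally show ?thesis .
qed

lemma middle_swap4_nat:
  assumes "a \<in> Arr C" "b \<in> Arr C" "d \<in> Arr C" "e \<in> Arr C"
  shows "middle_swap4 (Cod C a) (Cod C b) (Cod C d) (Cod C e) \<cdot> ((a \<otimes> b) \<otimes> (d \<otimes> e)) =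
    ((a \<otimes> d) \<otimes> (b \<otimes> e)) \<cdot> middle_swap4 (Dom C a) (Dom C b) (Dom C d) (Dom C e)"
proof -
  let ?s = "assoc C (Dom C a) (Dom C b) (Dom C d \<boxtimes> Dom C e)"
  let ?r = "arr_inv C (assoc C (Cod C a) (Cod C d) (Cod C b \<boxtimes> Cod C e))"
  have "middle_swap4 (Cod C a) (Cod C b) (Cod C d) (Cod C e) \<cdot> ((a \<otimes> b) \<otimes> (d \<otimes> e)) =
    ?r \<cdot> (a \<otimes> ((d \<otimes> (b \<otimes> e)) \<cdot> inner_swap (Dom C b) (Dom C d) (Dom C e))) \<cdot> ?s"
    using assms by (simp add: middle_swap4_def assoc_nat inner_swap_nat)
  also have "\<dots> = (?r \<cdot> (a \<otimes> (d \<otimes> (b \<otimes> e)))) \<cdot> (ide C (Dom C a) \<otimes> inner_swap (Dom C b) (Dom C d) (Dom C e)) \<cdot> ?s"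
    using assms by simp
  also have "\<dots> = ((a \<otimes> d) \<otimes> (b \<otimes> e)) \<cdot> middle_swap4 (Dom C a) (Dom C b) (Dom C d) (Dom C e)"
    using assms by (subst assoc_inv_nat) (simp_all add: middle_swap4_def)
  finally show ?thesis .
qed

end

section \<open>Pairing and deterministic morphisms\<close>

context markov_category
begin

section \<open>Uniqueness of morphisms into the unit, and pairing\<close>

lemma copy_del_simps [simp]:
  assumes "A \<in> Obj C"
  shows "copy C A \<in> Arr C" "Dom C (copy C A) = A" "Cod C (copy C A) = A \<boxtimes> A"
    "del C A \<in> Arr C" "Dom C (del C A) = A" "Cod C (del C A) = \<I>"
  using homD[OF copy_hom[OF assms]] homD[OF del_hom[OF assms]] by auto

lemma terminal_eq:
  assumes "f \<in> Arr C" "g \<in> Arr C" "Dom C f = Dom C g" "Cod C f = \<I>" "Cod C g = \<I>"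
  shows "f = g"
  using unit_terminal[of "Dom C g"] assms by (auto simp: hom_def)

text \<open>The left unitor identifies \<open>\<I> \<boxtimes> \<I>\<close> with the terminal
  object.\<close>

lemma terminal_eq_tensor:
  assumes "f \<in> Arr C" "g \<in> Arr C" "Dom C f = Dom C g" "Cod C f = \<I> \<boxtimes> \<I>" "Cod C g = \<I> \<boxtimes> \<I>"
  shows "f = g"
proof (rule iso_cancel_left)
  show "lunit C \<I> \<cdot> f = lunit C \<I> \<cdot> g"
    by (rule terminal_eq) (use assms in auto)
qed (use assms lunit_iso in auto)

lemma del_nat [simp]:
  assumes "f \<in> Arr C" "Cod C f = A"
  shows "del C A \<cdot> f = del C (Dom C f)"
  by (rule terminal_eq) (use assms in auto)

text \<open>Not the pairing of a categorical product: in general a morphism into a tensor is not the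
  pair of its marginals, and precomposition does not distribute over pairs.\<close>

definition pair :: "'m \<Rightarrow> 'm \<Rightarrow> 'm" where
  "pair a b = (a \<otimes> b) \<cdot> copy C (Dom C a)"

lemma pair_simps [simp]:
  assumes "a \<in> Arr C" "b \<in> Arr C" "Dom C a = Dom C b"
  shows "pair a b \<in> Arr C" "Dom C (pair a b) = Dom C b" "Cod C (pair a b) = Cod C a \<boxtimes> Cod C b"
  using assms by (auto simp: pair_def)

lemma pair_ide: "A \<in> Obj C \<Longrightarrow> pair (ide C A) (ide C A) = copy C A"
  by (simp add: pair_def)

lemma tens_pair [simp]:
  assumes "a \<in> Arr C" "b \<in> Arr C" "Dom C a = Dom C b"
    and "a' \<in> Arr C" "b' \<in> Arr C" "Dom C a' = Cod C a" "Dom C b' = Cod C b"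
  shows "(a' \<otimes> b') \<cdot> pair a b = pair (a' \<cdot> a) (b' \<cdot> b)"
  using assms by (simp add: pair_def)

lemma tens_copy:
  assumes "a \<in> Arr C" "b \<in> Arr C" "Dom C a = A" "Dom C b = A"
  shows "(a \<otimes> b) \<cdot> copy C A = pair a b"
  using assms by (simp add: pair_def)

section \<open>Projections and structural isomorphisms acting on pairs\<close>

lemma fst_snd_simps [simp]:
  assumes "A \<in> Obj C" "B \<in> Obj C"
  shows "fst_proj C A B \<in> Arr C" "Dom C (fst_proj C A B) = A \<boxtimes> B" "Cod C (fst_proj C A B) = A"
    "snd_proj C A B \<in> Arr C" "Dom C (snd_proj C A B) = A \<boxtimes> B" "Cod C (snd_proj C A B) = B"
  using assms by (auto simp: fst_proj_def snd_proj_def)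

text \<open>Deletion absorbs \<open>b\<close> because the unit is terminal; the unitor is natural in
  \<open>a\<close>.\<close>

lemma fst_proj_tens:
  assumes "a \<in> Arr C" "b \<in> Arr C" "Cod C a = A" "Cod C b = B"
  shows "fst_proj C A B \<cdot> (a \<otimes> b) = a \<cdot> fst_proj C (Dom C a) (Dom C b)"
proof -
  have "fst_proj C A B \<cdot> (a \<otimes> b) = runit C A \<cdot> ((a \<otimes> ide C \<I>) \<cdot> (ide C (Dom C a) \<otimes> del C (Dom C b)))"
    using assms by (auto simp: fst_proj_def)
  also have "\<dots> = (runit C A \<cdot> (a \<otimes> ide C \<I>)) \<cdot> (ide C (Dom C a) \<otimes> del C (Dom C b))"
    using assms by (subst cmp_assoc_right) auto
  also have "\<dots> = a \<cdot> fst_proj C (Dom C a) (Dom C b)"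
    using assms runit_natural[of a "Dom C a" A] by (simp add: hom_def fst_proj_def)
  finally show ?thesis .
qed

lemma snd_proj_tens:
  assumes "a \<in> Arr C" "b \<in> Arr C" "Cod C a = A" "Cod C b = B"
  shows "snd_proj C A B \<cdot> (a \<otimes> b) = b \<cdot> snd_proj C (Dom C a) (Dom C b)"
proof -
  have "snd_proj C A B \<cdot> (a \<otimes> b) = lunit C B \<cdot> ((ide C \<I> \<otimes> b) \<cdot> (del C (Dom C a) \<otimes> ide C (Dom C b)))"
    using assms by (auto simp: snd_proj_def)
  also have "\<dots> = (lunit C B \<cdot> (ide C \<I> \<otimes> b)) \<cdot> (del C (Dom C a) \<otimes> ide C (Dom C b))"
    using assms by (subst cmp_assoc_right) auto
  also have "\<dots> = b \<cdot> snd_proj C (Dom C a) (Dom C b)"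
    using assms lunit_natural[of b "Dom C b" B] by (simp add: hom_def snd_proj_def)
  finally show ?thesis .
qed

text \<open>Naturality of the projection removes \<open>b\<close>, and what is left is the counit
  law of copying.\<close>

lemma fst_pair [simp]:
  assumes "a \<in> Arr C" "b \<in> Arr C" "Dom C a = Dom C b" "Cod C a = A" "Cod C b = B"
  shows "fst_proj C A B \<cdot> pair a b = a"
proof -
  have "fst_proj C A B \<cdot> pair a b = (fst_proj C A B \<cdot> (a \<otimes> b)) \<cdot> copy C (Dom C b)"
    using assms by (subst cmp_assoc_right) (auto simp: pair_def)
  also have "\<dots> = a \<cdot> fst_proj C (Dom C b) (Dom C b) \<cdot> copy C (Dom C b)"
    using assms by (simp add: fst_proj_tens)
  also have "\<dots> = a"
    using assms copy_counit_right[of "Dom C b"] by (simp add: fst_proj_def)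
  finally show ?thesis .
qed

lemma snd_pair [simp]:
  assumes "a \<in> Arr C" "b \<in> Arr C" "Dom C a = Dom C b" "Cod C a = A" "Cod C b = B"
  shows "snd_proj C A B \<cdot> pair a b = b"
proof -
  have "snd_proj C A B \<cdot> pair a b = (snd_proj C A B \<cdot> (a \<otimes> b)) \<cdot> copy C (Dom C b)"
    using assms by (subst cmp_assoc_right) (auto simp: pair_def)
  also have "\<dots> = b \<cdot> snd_proj C (Dom C b) (Dom C b) \<cdot> copy C (Dom C b)"
    using assms by (simp add: snd_proj_tens)
  also have "\<dots> = b"
    using assms copy_counit_left[of "Dom C b"] by (simp add: snd_proj_def)
  finally show ?thesis .
qed

lemma swap_pair [simp]:
  assumes "a \<in> Arr C" "b \<in> Arr C" "Dom C a = Dom C b" "Cod C a = A" "Cod C b = B"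
  shows "swap C A B \<cdot> pair a b = pair b a"
proof -
  have "swap C A B \<cdot> pair a b = (swap C A B \<cdot> (a \<otimes> b)) \<cdot> copy C (Dom C b)"
    using assms by (subst cmp_assoc_right) (auto simp: pair_def)
  also have "\<dots> = (b \<otimes> a) \<cdot> swap C (Dom C b) (Dom C b) \<cdot> copy C (Dom C b)"
    using assms by (subst swap_nat) auto
  also have "\<dots> = pair b a"
    using assms by (simp add: copy_commutative pair_def)
  finally show ?thesis .
qed

text \<open>Coassociativity of copying, carried through the naturality of the associator.\<close>

lemma assoc_pair [simp]:
  assumes "a \<in> Arr C" "b \<in> Arr C" "c \<in> Arr C" "Dom C a = Dom C c" "Dom C b = Dom C c"
    "Cod C a = A" "Cod C b = B" "Cod C c = D"
  shows "assoc C A B D \<cdot> pair (pair a b) c = pair a (pair b c)"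
proof -
  let ?X = "Dom C c"
  have "assoc C A B D \<cdot> pair (pair a b) c =
      assoc C A B D \<cdot> (((a \<otimes> b) \<otimes> c) \<cdot> ((copy C ?X \<otimes> ide C ?X) \<cdot> copy C ?X))"
    using assms by (auto simp: pair_def)
  also have "\<dots> = (assoc C A B D \<cdot> ((a \<otimes> b) \<otimes> c)) \<cdot> ((copy C ?X \<otimes> ide C ?X) \<cdot> copy C ?X)"
    using assms by (subst cmp_assoc_right) auto
  also have "\<dots> = (a \<otimes> (b \<otimes> c)) \<cdot> (assoc C ?X ?X ?X \<cdot> (copy C ?X \<otimes> ide C ?X) \<cdot> copy C ?X)"
    using assms by (subst assoc_nat) auto
  also have "\<dots> = pair a (pair b c)"
    using assms by (subst copy_coassoc) (auto simp: pair_def)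
  finally show ?thesis .
qed

lemma assoc_inv_pair [simp]:
  assumes "a \<in> Arr C" "b \<in> Arr C" "c \<in> Arr C" "Dom C a = Dom C c" "Dom C b = Dom C c"
    "Cod C a = A" "Cod C b = B" "Cod C c = D"
  shows "arr_inv C (assoc C A B D) \<cdot> pair a (pair b c) = pair (pair a b) c"
  by (rule arr_inv_move) (use assms assoc_iso in auto)

lemma inner_swap_pair [simp]:
  assumes "a \<in> Arr C" "b \<in> Arr C" "c \<in> Arr C" "Dom C a = Dom C c" "Dom C b = Dom C c"
    "Cod C a = A" "Cod C b = B" "Cod C c = D"
  shows "inner_swap A B D \<cdot> pair a (pair b c) = pair b (pair a c)"
  using assms by (auto simp: inner_swap_def)

lemma middle_swap4_pair:
  assumes "a \<in> Arr C" "b \<in> Arr C" "c \<in> Arr C" "d \<in> Arr C"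
    "Dom C a = Dom C d" "Dom C b = Dom C d" "Dom C c = Dom C d"
    "Cod C a = A" "Cod C b = B" "Cod C c = D" "Cod C d = E"
  shows "middle_swap4 A B D E \<cdot> pair (pair a b) (pair c d) = pair (pair a c) (pair b d)"
  using assms by (auto simp: middle_swap4_def)

lemma copy_tens: "\<lbrakk>A \<in> Obj C; B \<in> Obj C\<rbrakk>
    \<Longrightarrow> copy C (A \<boxtimes> B) = middle_swap4 A A B B \<cdot> (copy C A \<otimes> copy C B)"
  by (simp add: copy_tensor middle_swap_eq)

text \<open>The middle swap of \<open>A \<boxtimes> \<I>\<close> and \<open>\<I> \<boxtimes> B\<close> exchanges two unit objects only, and \<open>\<I> \<boxtimes> \<I>\<close>
  is terminal.\<close>

lemma middle_swap4_unit:
  assumes "A \<in> Obj C" "B \<in> Obj C"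
  shows "middle_swap4 A \<I> \<I> B = ide C ((A \<boxtimes> \<I>) \<boxtimes> (\<I> \<boxtimes> B))"
proof -
  have "swap C \<I> \<I> = ide C (\<I> \<boxtimes> \<I>)"
    by (rule terminal_eq_tensor) auto
  then show ?thesis
    using assms by (simp add: middle_swap4_def inner_swap_def)
qed

text \<open>This rests on the compatibility of copying with \<open>\<otimes>\<close>: copying
  \<open>A \<boxtimes> B\<close> copies each factor, and the two counit laws then delete one copy of
  each.\<close>

lemma pair_fst_snd [simp]:
  assumes "A \<in> Obj C" "B \<in> Obj C"
  shows "pair (fst_proj C A B) (snd_proj C A B) = ide C (A \<boxtimes> B)"
proof -
  let ?m = "middle_swap4 A A B B" and ?cc = "copy C A \<otimes> copy C B"
  have "pair (fst_proj C A B) (snd_proj C A B) =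
      (runit C A \<otimes> lunit C B) \<cdot> ((((ide C A \<otimes> del C B) \<otimes> (del C A \<otimes> ide C B)) \<cdot> ?m) \<cdot> ?cc)"
    using assms by (simp add: pair_def fst_proj_def snd_proj_def copy_tens)
  \<comment> \<open>Naturality turns the middle swap into one at \<open>A\<close>,
    \<open>\<I>\<close>, \<open>\<I>\<close>, \<open>B\<close>, which is an identity.\<close>
  also have "((ide C A \<otimes> del C B) \<otimes> (del C A \<otimes> ide C B)) \<cdot> ?m =
      (ide C A \<otimes> del C A) \<otimes> (del C B \<otimes> ide C B)"
    using middle_swap4_nat[of "ide C A" "del C A" "del C B" "ide C B"] assms
    by (simp add: middle_swap4_unit)
  also have "(runit C A \<otimes> lunit C B) \<cdot> (\<dots> \<cdot> ?cc) = ide C (A \<boxtimes> B)"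
    using assms copy_counit_left[of B] copy_counit_right[of A] by simp
  finally show ?thesis .
qed

section \<open>Deterministic morphisms and their closure properties\<close>

lemma deterministic_arr: "deterministic C f \<Longrightarrow> f \<in> Arr C"
  by (simp add: deterministic_def)

text \<open>A deterministic \<open>d\<close> followed by copying is copying followed by two
  instances of \<open>d\<close>, one for each component.\<close>

lemma pair_cmp_deterministic:
  assumes "deterministic C d" "a \<in> Arr C" "b \<in> Arr C" "Dom C a = Cod C d" "Dom C b = Cod C d"
  shows "pair a b \<cdot> d = pair (a \<cdot> d) (b \<cdot> d)"
  using assms by (simp add: pair_def deterministic_def)

lemma deterministicI:
  assumes "d \<in> Arr C" "copy C (Cod C d) \<cdot> d = pair d d"
  shows "deterministic C d"
  using assms by (simp add: pair_def deterministic_def)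

lemma copy_cmp_deterministic:
  "\<lbrakk>deterministic C d; Cod C d = A\<rbrakk> \<Longrightarrow> copy C A \<cdot> d = pair d d"
  by (auto simp: pair_def deterministic_def)

lemma deterministic_ide [simp]: "A \<in> Obj C \<Longrightarrow> deterministic C (ide C A)"
  by (simp add: deterministicI pair_def)

lemma deterministic_cmp:
  assumes "deterministic C d" "deterministic C e" "Dom C e = Cod C d"
  shows "deterministic C (e \<cdot> d)"
proof (rule deterministicI)
  note [simp] = deterministic_arr[OF assms(1)] deterministic_arr[OF assms(2)]
  have "copy C (Cod C e) \<cdot> (e \<cdot> d) = (copy C (Cod C e) \<cdot> e) \<cdot> d"
    using assms(3) by (subst cmp_assoc_right) auto
  then show "copy C (Cod C (e \<cdot> d)) \<cdot> e \<cdot> d = pair (e \<cdot> d) (e \<cdot> d)"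
    using assms by (simp add: copy_cmp_deterministic pair_cmp_deterministic)
qed (use assms deterministic_arr in auto)

lemma deterministic_tens:
  assumes "deterministic C d" "deterministic C e"
  shows "deterministic C (d \<otimes> e)"
proof -
  note [simp] = deterministic_arr[OF assms(1)] deterministic_arr[OF assms(2)]
  let ?m = "middle_swap4 (Cod C d) (Cod C d) (Cod C e) (Cod C e)"
  have "copy C (Cod C d \<boxtimes> Cod C e) \<cdot> (d \<otimes> e) = ?m \<cdot> (pair d d \<otimes> pair e e)"
    using assms by (simp add: copy_tens copy_cmp_deterministic)
  also have "\<dots> = (?m \<cdot> ((d \<otimes> d) \<otimes> (e \<otimes> e))) \<cdot> (copy C (Dom C d) \<otimes> copy C (Dom C e))"
    by (simp add: pair_def)
  also have "\<dots> = ((d \<otimes> e) \<otimes> (d \<otimes> e)) \<cdot> copy C (Dom C d \<boxtimes> Dom C e)"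
    by (subst middle_swap4_nat) (auto simp: copy_tens)
  finally show ?thesis
    by (simp add: deterministic_def)
qed

text \<open>All four components of the iterated copy are identities, so the middle swap, which only
  permutes components, leaves it fixed.\<close>

lemma deterministic_copy:
  assumes "A \<in> Obj C"
  shows "deterministic C (copy C A)"
proof (rule deterministicI)
  let ?c = "pair (ide C A) (ide C A)"
  have "copy C (A \<boxtimes> A) \<cdot> copy C A = middle_swap4 A A A A \<cdot> pair ?c ?c"
    using assms by (simp add: copy_tens pair_def)
  also have "\<dots> = pair ?c ?c"
    using assms by (simp add: middle_swap4_pair)
  finally show "copy C (Cod C (copy C A)) \<cdot> copy C A = pair (copy C A) (copy C A)"
    using assms by (simp add: pair_ide)
qed (use assms in auto)

lemma deterministic_pair:
  assumes "deterministic C d" "deterministic C e" "Dom C d = Dom C e"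
  shows "deterministic C (pair d e)"
  unfolding pair_def
  by (intro deterministic_cmp deterministic_copy deterministic_tens assms) (use assms deterministic_arr in auto)

lemma deterministic_del: "A \<in> Obj C \<Longrightarrow> deterministic C (del C A)"
  unfolding deterministic_def by (intro conjI terminal_eq_tensor) auto

text \<open>Inserting \<open>d \<cdot> e\<close> before \<open>pair e e\<close> and moving
  \<open>d\<close> into the pair cancels both instances of \<open>e\<close>, leaving the copy
  map.\<close>

lemma deterministic_inverse:
  assumes "deterministic C d" "inverse_arrows C d e"
  shows "deterministic C e"
proof (rule deterministicI)
  show e: "e \<in> Arr C"
    using assms(2) by (auto simp: inverse_arrows_def hom_def)
  have *: "d \<in> Arr C" "Dom C e = Cod C d" "Cod C e = Dom C d" "e \<cdot> d = ide C (Dom C d)" "d \<cdot> e = ide C (Cod C d)"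
    using assms(2) by (auto simp: inverse_arrows_def hom_def)
  have "pair e e = pair e e \<cdot> (d \<cdot> e)"
    using e * by simp
  also have "\<dots> = (pair e e \<cdot> d) \<cdot> e"
    using e *(1-3) by (subst cmp_assoc_right) auto
  also have "pair e e \<cdot> d = copy C (Dom C d)"
    using e * assms(1) by (simp add: pair_cmp_deterministic pair_ide)
  finally show "copy C (Cod C e) \<cdot> e = pair e e"
    using * by simp
qed

text \<open>The unitor is the inverse of \<open>pair (ide C A) (del C A)\<close>, a pair of
  deterministic maps.\<close>

lemma deterministic_runit:
  assumes "A \<in> Obj C"
  shows "deterministic C (runit C A)"
proof (rule deterministic_inverse)
  let ?i = "pair (ide C A) (del C A)"
  show "deterministic C ?i"
    using assms by (intro deterministic_pair deterministic_del) auto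
  have 1: "runit C A \<cdot> ?i = ide C A"
    using assms copy_counit_right[OF assms] by (simp add: pair_def)
  \<comment> \<open>The counit law gives only one of the two inverse laws; the other follows by
    cancelling the isomorphism \<open>runit C A\<close> on the left.\<close>
  have "?i \<cdot> runit C A = ide C (A \<boxtimes> \<I>)"
  proof (rule iso_cancel_left[OF runit_iso[OF assms]])
    show "runit C A \<cdot> ?i \<cdot> runit C A = runit C A \<cdot> ide C (A \<boxtimes> \<I>)"
      using 1 assms cmp_assoc_right[of "runit C A" ?i "runit C A"] by simp
  qed (use assms in auto)
  then show "inverse_arrows C ?i (runit C A)"
    using 1 assms by (auto simp: inverse_arrows_def hom_def)
qed

lemma deterministic_fst [simp]: "\<lbrakk>A \<in> Obj C; B \<in> Obj C\<rbrakk> \<Longrightarrow> deterministic C (fst_proj C A B)"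
  unfolding fst_proj_def
  by (intro deterministic_cmp deterministic_runit deterministic_tens deterministic_ide deterministic_del) auto

lemma deterministic_lunit:
  assumes "A \<in> Obj C"
  shows "deterministic C (lunit C A)"
proof (rule deterministic_inverse)
  let ?i = "pair (del C A) (ide C A)"
  show "deterministic C ?i"
    using assms by (intro deterministic_pair deterministic_del) auto
  have 1: "lunit C A \<cdot> ?i = ide C A"
    using assms copy_counit_left[OF assms] by (simp add: pair_def)
  have "?i \<cdot> lunit C A = ide C (\<I> \<boxtimes> A)"
  proof (rule iso_cancel_left[OF lunit_iso[OF assms]])
    show "lunit C A \<cdot> ?i \<cdot> lunit C A = lunit C A \<cdot> ide C (\<I> \<boxtimes> A)"
      using 1 assms cmp_assoc_right[of "lunit C A" ?i "lunit C A"] by simp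
  qed (use assms in auto)
  then show "inverse_arrows C ?i (lunit C A)"
    using 1 assms by (auto simp: inverse_arrows_def hom_def)
qed

lemma deterministic_snd [simp]: "\<lbrakk>A \<in> Obj C; B \<in> Obj C\<rbrakk> \<Longrightarrow> deterministic C (snd_proj C A B)"
  unfolding snd_proj_def
  by (intro deterministic_cmp deterministic_lunit deterministic_tens deterministic_ide deterministic_del) auto

text \<open>Inserting the identity as a pair of projections brings tensors into the form on which
  the pair rules act.\<close>

lemma tens_eq_pair:
  assumes "a \<in> Arr C" "b \<in> Arr C"
  shows "a \<otimes> b = pair (a \<cdot> fst_proj C (Dom C a) (Dom C b)) (b \<cdot> snd_proj C (Dom C a) (Dom C b))"
proof -
  have "a \<otimes> b = (a \<otimes> b) \<cdot> pair (fst_proj C (Dom C a) (Dom C b)) (snd_proj C (Dom C a) (Dom C b))"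
    using assms by (simp del: tens_pair)
  also have "\<dots> = pair (a \<cdot> fst_proj C (Dom C a) (Dom C b)) (b \<cdot> snd_proj C (Dom C a) (Dom C b))"
    using assms by (simp del: pair_fst_snd)
  finally show ?thesis .
qed

section \<open>Conditionals and almost sure equality in terms of pairs\<close>

lemma cmp_cmp_eq:
  assumes "a \<cdot> b = c" "a \<in> Arr C" "b \<in> Arr C" "r \<in> Arr C" "Dom C a = Cod C b" "Dom C b = Cod C r"
  shows "a \<cdot> (b \<cdot> r) = c \<cdot> r"
  using cmp_assoc_right[of r b a] assms by simp

text \<open>Projections are deterministic, so the graph of \<open>d\<close> distributes over
  \<open>fst_proj\<close>; rebracketing is then \<open>assoc_pair\<close>. The case of an identity
  \<open>d\<close> describes copying the past observations.\<close>

lemma assoc_graph_tens: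
  assumes "deterministic C d" "Dom C d = W" "Cod C d = A" "D \<in> Obj C"
  shows "assoc C W A D \<cdot> (pair (ide C W) d \<otimes> ide C D) =
    pair (fst_proj C W D) (pair (d \<cdot> fst_proj C W D) (snd_proj C W D))"
proof -
  note [simp] = deterministic_arr[OF assms(1)]
  have "W \<in> Obj C" "A \<in> Obj C"
    using assms by auto
  then show ?thesis
    using assms by (auto simp: tens_eq_pair[of _ "ide C D"] pair_cmp_deterministic)
qed

text \<open>The string diagram of a conditional in two stages: pair the input with the marginal on
  \<open>Y\<close>, then output the value of \<open>k\<close> next to \<open>Y\<close>.\<close>

lemma conditional_eq:
  assumes "conditional C A X Y f k" and y: "Y \<in> Obj C"
  shows "f = pair k (snd_proj C A Y) \<cdot> pair (ide C A) (snd_proj C X Y \<cdot> f)"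
proof -
  have k: "k \<in> Arr C" "Dom C k = A \<boxtimes> Y" "Cod C k = X"
    and f: "f \<in> Arr C" "Dom C f = A" "Cod C f = X \<boxtimes> Y"
    and eq: "f = (k \<otimes> ide C Y) \<cdot> arr_inv C (assoc C A Y Y) \<cdot> (ide C A \<otimes> copy C Y)
         \<cdot> (ide C A \<otimes> (snd_proj C X Y \<cdot> f)) \<cdot> copy C A"
    using assms(1) by (auto simp: conditional_def hom_def)
  have o: "A \<in> Obj C" "X \<in> Obj C"
    using k(1,3) f(1,2) by auto
  \<comment> \<open>Copying \<open>Y\<close> and rebracketing sends \<open>(a, y)\<close> to
    \<open>((a, y), y)\<close>, so \<open>k\<close> sees the whole input while \<open>y\<close>
    survives.\<close>
  have "pair k (snd_proj C A Y) =
      (k \<otimes> ide C Y) \<cdot> arr_inv C (assoc C A Y Y) \<cdot> pair (fst_proj C A Y) (pair (snd_proj C A Y) (snd_proj C A Y))"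
    using k o y by auto
  also have "pair (fst_proj C A Y) (pair (snd_proj C A Y) (snd_proj C A Y)) = ide C A \<otimes> copy C Y"
    using o y by (simp add: tens_eq_pair[of "ide C A"] copy_cmp_deterministic)
  finally have "pair k (snd_proj C A Y) \<cdot> pair (ide C A) (snd_proj C X Y \<cdot> f) =
      (k \<otimes> ide C Y) \<cdot> arr_inv C (assoc C A Y Y) \<cdot> (ide C A \<otimes> copy C Y)
         \<cdot> pair (ide C A) (snd_proj C X Y \<cdot> f)"
    using k f o y by (simp del: tens_pair)
  also have "\<dots> = f"
    \<comment> \<open>Only the \<open>f\<close> on the right is expanded; the one inside the
      marginal has to stay.\<close>
    using f o y by (subst (2) eq) (simp add: tens_copy del: tens_pair interchange interchange_cmp)
  finally show ?thesis ..
qed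

lemma as_equal_iff_pair:
  assumes "q \<in> Arr C" "a \<in> Arr C" "b \<in> Arr C" "Dom C a = Cod C q" "Dom C b = Cod C q"
  shows "as_equal C q a b \<longleftrightarrow> pair (ide C (Cod C q)) a \<cdot> q = pair (ide C (Cod C q)) b \<cdot> q"
  using assms by (simp add: as_equal_def pair_def)

text \<open>If \<open>u\<close> disintegrates \<open>k\<close>, then \<open>u\<close> after
  \<open>d \<otimes> id\<close> disintegrates \<open>k \<cdot> d\<close>, even with the input
  \<open>W\<close> retained. The inner swap puts the \<open>B\<close> factor first, as in the joint
  law of state and observations.\<close>

lemma conditional_after_deterministic:
  assumes k: "k = pair u (snd_proj C A D) \<cdot> pair (ide C A) m"
    and u: "u \<in> Arr C" "Dom C u = A \<boxtimes> D" "Cod C u = B"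
    and m: "m \<in> Arr C" "Dom C m = A" "Cod C m = D"
    and d: "deterministic C d" "Dom C d = W" "Cod C d = A"
  shows "inner_swap W B D \<cdot> pair (ide C W) (k \<cdot> d) =
    pair (u \<cdot> pair (d \<cdot> fst_proj C W D) (snd_proj C W D)) (ide C (W \<boxtimes> D)) \<cdot> pair (ide C W) (m \<cdot> d)"
proof -
  note [simp] = deterministic_arr[OF d(1)] d(2,3) u m
  have [simp]: "A \<in> Obj C" "D \<in> Obj C" "B \<in> Obj C" "W \<in> Obj C"
    using Dom_Obj[of m] Cod_Obj[of m] Cod_Obj[of u] Dom_Obj[of d] by simp_all
  let ?U = "pair u (snd_proj C A D)" and ?dd = "pair (d \<cdot> fst_proj C W D) (snd_proj C W D)"
  let ?T = "pair (fst_proj C W D) ?dd"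
  have dd: "deterministic C ?dd"
    by (intro deterministic_pair deterministic_cmp d) auto
  have "?T \<cdot> pair (ide C W) (m \<cdot> d) =
      assoc C W A D \<cdot> (pair (ide C W) d \<otimes> ide C D) \<cdot> pair (ide C W) (m \<cdot> d)"
    using d by (simp add: assoc_graph_tens[symmetric] del: tens_pair)
  also have "\<dots> = pair (ide C W) (pair d (m \<cdot> d))"
    by simp
  \<comment> \<open>Determinism of \<open>d\<close> merges its two independent instances into a
    single one.\<close>
  also have "\<dots> = pair (ide C W) (pair (ide C A) m \<cdot> d)"
    using d by (simp add: pair_cmp_deterministic)
  finally have 1: "?T \<cdot> pair (ide C W) (m \<cdot> d) = pair (ide C W) (pair (ide C A) m \<cdot> d)" .
  have "pair (ide C W) (k \<cdot> d) = (ide C W \<otimes> ?U) \<cdot> (?T \<cdot> pair (ide C W) (m \<cdot> d))"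
    unfolding 1 by (simp add: k)
  also have "\<dots> = ((ide C W \<otimes> ?U) \<cdot> ?T) \<cdot> pair (ide C W) (m \<cdot> d)"
    by (subst cmp_assoc_right) auto
  \<comment> \<open>As \<open>?dd\<close> is deterministic, \<open>u\<close> and the retained
    \<open>D\<close> can each receive their own instance of it.\<close>
  also have "(ide C W \<otimes> ?U) \<cdot> ?T = pair (fst_proj C W D) (pair (u \<cdot> ?dd) (snd_proj C W D))"
    using dd by (simp add: pair_cmp_deterministic)
  finally have "inner_swap W B D \<cdot> pair (ide C W) (k \<cdot> d) =
     (inner_swap W B D \<cdot> pair (fst_proj C W D) (pair (u \<cdot> ?dd) (snd_proj C W D))) \<cdot> pair (ide C W) (m \<cdot> d)"
    by (simp del: inner_swap_pair)
  then show ?thesis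
    by simp
qed

section \<open>Iterated tensor products and deterministic counterparts\<close>

lemma tensO_upto_Obj [simp]: "(\<And>s. s \<le> t \<Longrightarrow> Z s \<in> Obj C) \<Longrightarrow> tensO_upto C Z t \<in> Obj C"
  by (induction t) auto

lemma tensM_upto_simps:
  assumes "\<And>s. s \<le> t \<Longrightarrow> k s \<in> hom C (Z s) (Z' s)"
  shows "tensM_upto C k t \<in> Arr C" "Dom C (tensM_upto C k t) = tensO_upto C Z t"
    "Cod C (tensM_upto C k t) = tensO_upto C Z' t"
  using assms by (induction t) (auto simp: hom_def)

lemma tensM_upto_cmp:
  assumes "\<And>s. s \<le> t \<Longrightarrow> k s \<in> hom C (Z s) (Z' s)" "\<And>s. s \<le> t \<Longrightarrow> k' s \<in> hom C (Z' s) (Z'' s)"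
    and "\<And>s. s \<le> t \<Longrightarrow> k' s \<cdot> k s = k'' s"
  shows "tensM_upto C k' t \<cdot> tensM_upto C k t = tensM_upto C k'' t"
  using assms
proof (induction t)
  case (Suc t)
  have "tensM_upto C k t \<in> Arr C" "tensM_upto C k' t \<in> Arr C"
    "Dom C (tensM_upto C k' t) = Cod C (tensM_upto C k t)"
    using tensM_upto_simps[of t k Z Z'] tensM_upto_simps[of t k' Z' Z''] Suc.prems by auto
  moreover have "k (Suc t) \<in> Arr C" "k' (Suc t) \<in> Arr C" "Dom C (k' (Suc t)) = Cod C (k (Suc t))"
    using Suc.prems(1,2)[of "Suc t"] by (auto simp: hom_def)
  ultimately show ?case
    using Suc by simp
qed simp

text \<open>Time \<open>0\<close> is separate because the iterated tensor starts at
  \<open>Z 0\<close>, without a unit factor to delete.\<close>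

definition last_proj :: "(nat \<Rightarrow> 'o) \<Rightarrow> nat \<Rightarrow> 'm" where
  "last_proj Z t = (case t of 0 \<Rightarrow> ide C (Z 0) | Suc r \<Rightarrow> snd_proj C (tensO_upto C Z r) (Z (Suc r)))"

lemma last_proj_simps:
  assumes "\<And>s. s \<le> t \<Longrightarrow> Z s \<in> Obj C"
  shows "last_proj Z t \<in> Arr C" "Dom C (last_proj Z t) = tensO_upto C Z t" "Cod C (last_proj Z t) = Z t"
  using assms by (auto simp: last_proj_def split: nat.split)

text \<open>Unifies the two cases of \<open>chain_step\<close>: the history is kept and
  \<open>h\<close> reads its last factor. For positive \<open>t\<close> the copy of that factor is
  moved past a deterministic projection.\<close>

lemma chain_step_eq:
  assumes "\<And>s. s \<le> t \<Longrightarrow> Z s \<in> Obj C" "h \<in> hom C (Z t) (Z (Suc t))"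
  shows "chain_step C Z t h = pair (ide C (tensO_upto C Z t)) (h \<cdot> last_proj Z t)"
proof (cases t)
  case 0
  then show ?thesis
    using homD[OF assms(2)] by (simp add: chain_step_def last_proj_def pair_def)
next
  case (Suc r)
  have [simp]: "tensO_upto C Z r \<in> Obj C" "Z (Suc r) \<in> Obj C"
    using assms Suc by auto
  note h = homD[OF assms(2), unfolded Suc]
  have "(ide C (Z (Suc r)) \<otimes> h) \<cdot> copy C (Z (Suc r)) = pair (ide C (Z (Suc r))) h"
    using h by (intro tens_copy) auto
  then show ?thesis
    using h Suc
    by (simp add: chain_step_def last_proj_def tens_eq_pair[of "ide C (tensO_upto C Z r)"]
      pair_cmp_deterministic del: pair_ide)
qed

lemma markov_chain_hom:
  assumes "\<And>s. s \<le> t \<Longrightarrow> Z s \<in> Obj C" "k 0 \<in> hom C \<I> (Z 0)" "\<And>s. s < t \<Longrightarrow> k (Suc s) \<in> hom C (Z s) (Z (Suc s))"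
  shows "markov_chain C Z k t \<in> hom C \<I> (tensO_upto C Z t)"
  using assms
proof (induction t)
  case (Suc t)
  have "last_proj Z t \<in> hom C (tensO_upto C Z t) (Z t)" "tensO_upto C Z t \<in> Obj C"
    using last_proj_simps[of t Z] Suc.prems(1) by (auto simp: hom_def)
  then show ?case
    using Suc.prems(3)[of t] Suc by (auto simp: chain_step_eq hom_def)
qed simp

section \<open>Deterministic counterparts\<close>

lemma sharp_simps:
  assumes "representable_by C P samp" "f \<in> Arr C"
  shows "sharp C P samp f \<in> Arr C" "Dom C (sharp C P samp f) = Dom C f"
    "Cod C (sharp C P samp f) = P (Cod C f)" "deterministic C (sharp C P samp f)"
    "samp (Cod C f) \<cdot> sharp C P samp f = f"
proof -
  have "\<exists>!k. k \<in> hom C (Dom C f) (P (Cod C f)) \<and> deterministic C k \<and> f = samp (Cod C f) \<cdot> k"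
    using assms Dom_Obj[of f] Cod_Obj[of f] by (simp add: representable_by_def hom_def)
  from theI'[OF this, folded sharp_def]
  show "sharp C P samp f \<in> Arr C" "Dom C (sharp C P samp f) = Dom C f"
    "Cod C (sharp C P samp f) = P (Cod C f)" "deterministic C (sharp C P samp f)"
    "samp (Cod C f) \<cdot> sharp C P samp f = f"
    by (auto simp: hom_def)
qed

lemma sharp_eqI:
  assumes "representable_by C P samp" "deterministic C k" "X \<in> Obj C" "Cod C k = P X" "f = samp X \<cdot> k"
  shows "sharp C P samp f = k"
proof -
  have k: "k \<in> Arr C" and samp: "samp X \<in> Arr C" "Dom C (samp X) = P X" "Cod C (samp X) = X"
    using assms deterministic_arr by (auto simp: representable_by_def hom_def)
  then have f: "f \<in> hom C (Dom C k) X" "Dom C k \<in> Obj C"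
    using assms by (auto simp: hom_def)
  then have ex: "\<exists>!l. l \<in> hom C (Dom C k) (P X) \<and> deterministic C l \<and> f = samp X \<cdot> l"
    using assms(1,3) by (auto simp: representable_by_def)
  have "Dom C f = Dom C k" "Cod C f = X"
    using f by (auto simp: hom_def)
  then show ?thesis
    unfolding sharp_def using k assms(2,4,5) by (intro the1_equality) (use ex in \<open>auto simp: hom_def\<close>)
qed

text \<open>The right-hand side is deterministic and sampling from it gives
  \<open>f \<cdot> d\<close>, so uniqueness of counterparts applies.\<close>

lemma sharp_cmp:
  assumes "representable_by C P samp" "f \<in> Arr C" "deterministic C d" "Cod C d = Dom C f"
  shows "sharp C P samp (f \<cdot> d) = sharp C P samp f \<cdot> d"
proof -
  note s = sharp_simps[OF assms(1,2)] and d = deterministic_arr[OF assms(3)]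
  have samp: "samp (Cod C f) \<in> Arr C" "Dom C (samp (Cod C f)) = P (Cod C f)"
    using assms(1,2) Cod_Obj[of f] by (auto simp: representable_by_def hom_def)
  have "f \<cdot> d = samp (Cod C f) \<cdot> (sharp C P samp f \<cdot> d)"
    using s samp d assms(4) cmp_cmp_eq[OF s(5)] by simp
  then show ?thesis
    using s d assms by (intro sharp_eqI[where X = "Cod C f"] deterministic_cmp) auto
qed

end

section \<open>Hidden Markov models\<close>

locale hidden_markov_model = markov_category C
  for C :: "('o, 'm, 'z) mcat_scheme" (structure) +
  fixes X Y :: "nat \<Rightarrow> 'o" and f g :: "nat \<Rightarrow> 'm" and n :: nat
  assumes kernels: "hmm_kernels C X Y f g n"
begin

section \<open>Marginals of the model\<close>

abbreviation state_chain :: "nat \<Rightarrow> 'm" where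
  "state_chain \<equiv> markov_chain C X f"

abbreviation obs_kernel :: "nat \<Rightarrow> 'm" where
  "obs_kernel \<equiv> tensM_upto C g"

text \<open>The observation law up to time \<open>t\<close> without reference to the horizon
  \<open>n\<close>; \<open>obs_marginal_eq\<close> identifies the two descriptions.\<close>

definition obs_state :: "nat \<Rightarrow> 'm" where
  "obs_state t = obs_kernel t \<cdot> state_chain t"

text \<open>The joint law of the current state and all observations so far, identified with the
  marginal of the model in \<open>state_obs_marginal_eq\<close>.\<close>

definition joint_state :: "nat \<Rightarrow> 'm" where
  "joint_state t = pair (last_proj X t) (obs_kernel t) \<cdot> state_chain t"

lemma kernel_simps [simp]:
  assumes "t \<le> n"
  shows "X t \<in> Obj C" "Y t \<in> Obj C" "g t \<in> Arr C" "Dom C (g t) = X t" "Cod C (g t) = Y t"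
  using kernels assms by (auto simp: hmm_kernels_def hom_def)

lemma transition_kernel_simps [simp]:
  shows "f 0 \<in> Arr C" "Dom C (f 0) = \<I>" "Cod C (f 0) = X 0"
    and "Suc t \<le> n \<Longrightarrow> f (Suc t) \<in> Arr C" "Suc t \<le> n \<Longrightarrow> Dom C (f (Suc t)) = X t"
    "Suc t \<le> n \<Longrightarrow> Cod C (f (Suc t)) = X (Suc t)"
  using kernels by (auto simp: hmm_kernels_def hom_def split: nat.splits)

lemma upto_Obj [simp]:
  assumes "t \<le> n"
  shows "tensO_upto C X t \<in> Obj C" "tensO_upto C Y t \<in> Obj C"
    "tensO_upto C (\<lambda>s. X s \<boxtimes> Y s) t \<in> Obj C"
  using assms by auto

lemma state_chain_simps [simp]:
  assumes "t \<le> n"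
  shows "state_chain t \<in> Arr C" "Dom C (state_chain t) = \<I>" "Cod C (state_chain t) = tensO_upto C X t"
proof -
  have "state_chain t \<in> hom C \<I> (tensO_upto C X t)"
    using assms by (intro markov_chain_hom) (auto simp: hom_def)
  then show "state_chain t \<in> Arr C" "Dom C (state_chain t) = \<I>" "Cod C (state_chain t) = tensO_upto C X t"
    by (auto simp: hom_def)
qed

lemma obs_kernel_simps [simp]:
  assumes "t \<le> n"
  shows "obs_kernel t \<in> Arr C" "Dom C (obs_kernel t) = tensO_upto C X t" "Cod C (obs_kernel t) = tensO_upto C Y t"
  using tensM_upto_simps[of t g X Y] assms by (auto simp: hom_def)

lemma last_proj_X_simps [simp]:
  assumes "t \<le> n"
  shows "last_proj X t \<in> Arr C" "Dom C (last_proj X t) = tensO_upto C X t" "Cod C (last_proj X t) = X t"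
  using last_proj_simps[of t X] assms by auto

lemma emission_simps:
  assumes "t \<le> n"
  defines "e \<equiv> tensM_upto C (\<lambda>s. (ide C (X s) \<otimes> g s) \<cdot> copy C (X s)) t"
  shows "e \<in> Arr C" "Dom C e = tensO_upto C X t" "Cod C e = tensO_upto C (\<lambda>s. X s \<boxtimes> Y s) t"
  unfolding e_def using assms(1)
  by (auto intro!: tensM_upto_simps[of t _ X "\<lambda>s. X s \<boxtimes> Y s"] homI)

lemma obs_proj_simps:
  assumes "t \<le> n"
  shows "obs_proj C X Y t \<in> Arr C" "Dom C (obs_proj C X Y t) = tensO_upto C (\<lambda>s. X s \<boxtimes> Y s) t"
    "Cod C (obs_proj C X Y t) = tensO_upto C Y t"
  unfolding obs_proj_def using assms
  by (auto intro!: tensM_upto_simps[of t _ "\<lambda>s. X s \<boxtimes> Y s" Y] homI)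

lemma obs_proj_emission:
  assumes "t \<le> n"
  shows "obs_proj C X Y t \<cdot> tensM_upto C (\<lambda>s. (ide C (X s) \<otimes> g s) \<cdot> copy C (X s)) t = obs_kernel t"
  unfolding obs_proj_def
  by (rule tensM_upto_cmp[of t _ X "\<lambda>s. X s \<boxtimes> Y s" _ Y]) (use assms in \<open>auto intro!: homI simp: tens_copy\<close>)

lemma state_chain_Suc:
  assumes "Suc t \<le> n"
  shows "state_chain (Suc t) = pair (ide C (tensO_upto C X t)) (f (Suc t) \<cdot> last_proj X t) \<cdot> state_chain t"
  using assms by (simp add: chain_step_eq hom_def)

lemma initial_proj_simps:
  assumes "m \<le> n" "t \<le> m"
  shows "initial_proj C (\<lambda>s. X s \<boxtimes> Y s) t m \<in> Arr C"
    "Dom C (initial_proj C (\<lambda>s. X s \<boxtimes> Y s) t m) = tensO_upto C (\<lambda>s. X s \<boxtimes> Y s) m"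
    "Cod C (initial_proj C (\<lambda>s. X s \<boxtimes> Y s) t m) = tensO_upto C (\<lambda>s. X s \<boxtimes> Y s) t"
  using assms
proof (induction m)
  case (Suc m)
  {
    case 1 with Suc show ?case by (cases "t \<le> m") auto
  next
    case 2 with Suc show ?case by (cases "t \<le> m") auto
  next
    case 3 with Suc show ?case by (cases "t \<le> m") (auto simp: le_Suc_eq)
  }
qed auto

text \<open>Later states and emissions are generated after the earlier ones, so deleting them leaves
  the model with the shorter horizon.\<close>

lemma initial_proj_hmm:
  assumes "m \<le> n" "t \<le> m"
  shows "initial_proj C (\<lambda>s. X s \<boxtimes> Y s) t m \<cdot> hmm C X f g m = hmm C X f g t"
  using assms
proof (induction m)
  case 0
  then show ?case
    using emission_simps[of 0] by (simp add: hmm_def)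
next
  case (Suc m)
  let ?e = "\<lambda>s. (ide C (X s) \<otimes> g s) \<cdot> copy C (X s)" and ?XY = "\<lambda>s. X s \<boxtimes> Y s"
  let ?E = "tensM_upto C ?e m" and ?fst = "fst_proj C (tensO_upto C ?XY m) (?XY (Suc m))"
  note [simp] = emission_simps[of m]
  show ?case
  proof (cases "t \<le> m")
    case True
    let ?c = "pair (ide C (tensO_upto C X m)) (f (Suc m) \<cdot> last_proj X m)"
    \<comment> \<open>The newest state and emission form the second component of a pair, which the
      projection deletes.\<close>
    have "?fst \<cdot> hmm C X f g (Suc m) = ?fst \<cdot> (((?E \<otimes> ?e (Suc m)) \<cdot> ?c) \<cdot> state_chain m)"
      using Suc.prems unfolding hmm_def
      by (subst state_chain_Suc) (auto simp del: tens_pair)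
    also have "\<dots> = (?fst \<cdot> ((?E \<otimes> ?e (Suc m)) \<cdot> ?c)) \<cdot> state_chain m"
      using Suc.prems by (subst cmp_assoc_right) auto
    also have "\<dots> = hmm C X f g m"
      using Suc.prems by (simp add: hmm_def)
    finally have fst: "?fst \<cdot> hmm C X f g (Suc m) = hmm C X f g m" .
    have "hmm C X f g (Suc m) \<in> Arr C" "Cod C (hmm C X f g (Suc m)) = tensO_upto C ?XY (Suc m)"
      using Suc.prems emission_simps[of "Suc m"]
      by (auto simp: hmm_def simp del: tensM_upto.simps markov_chain.simps)
    then have "initial_proj C ?XY t (Suc m) \<cdot> hmm C X f g (Suc m) =
        initial_proj C ?XY t m \<cdot> ?fst \<cdot> hmm C X f g (Suc m)"
      using Suc.prems True initial_proj_simps[of m t] by simp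
    then show ?thesis
      using Suc True by (simp add: fst)
  next
    case False
    then have "t = Suc m"
      using Suc.prems by simp
    then show ?thesis
      using Suc.prems emission_simps[of "Suc m"] upto_Obj(3)[of "Suc m"]
      by (simp add: hmm_def del: tensM_upto.simps tensO_upto.simps markov_chain.simps)
  qed
qed

lemma obs_marginal_eq:
  assumes "t \<le> n"
  shows "obs_marginal C X Y (hmm C X f g n) n t = obs_state t"
  using assms emission_simps[OF assms] obs_proj_simps[OF assms] cmp_cmp_eq[OF obs_proj_emission[OF assms]]
  by (simp add: obs_marginal_def initial_proj_hmm obs_state_def hmm_def[of C X f g t])

lemma state_obs_proj_emission:
  assumes "t \<le> n"
  shows "state_obs_proj C X Y t \<cdot> tensM_upto C (\<lambda>s. (ide C (X s) \<otimes> g s) \<cdot> copy C (X s)) t =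
    pair (last_proj X t) (obs_kernel t)"
proof (cases t)
  case 0
  then show ?thesis
    by (simp add: state_obs_proj_def last_proj_def tens_copy)
next
  case (Suc r)
  let ?e = "\<lambda>s. (ide C (X s) \<otimes> g s) \<cdot> copy C (X s)"
  let ?W = "inner_swap (tensO_upto C Y r) (X t) (Y t)"
  have r: "r \<le> n"
    using assms Suc by simp
  note [simp] = obs_proj_simps[OF r] emission_simps[OF r] r assms
  have [simp]: "X (Suc r) \<in> Obj C" "Y (Suc r) \<in> Obj C" "Suc r \<le> n"
    using assms Suc by auto
  have e: "?e (Suc r) = pair (ide C (X t)) (g t)"
    using Suc by (simp add: tens_copy)
  have "state_obs_proj C X Y t \<cdot> tensM_upto C ?e t =
      ?W \<cdot> (obs_proj C X Y r \<otimes> ide C (X t \<boxtimes> Y t)) \<cdot> (tensM_upto C ?e r \<otimes> pair (ide C (X t)) (g t))"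
    using Suc by (simp add: state_obs_proj_def inner_swap_def e del: interchange)
  also have "\<dots> = ?W \<cdot> (obs_kernel r \<otimes> pair (ide C (X t)) (g t))"
    using Suc by (simp add: obs_proj_emission)
  \<comment> \<open>The inner swap exchanges the past observations with the current state, leaving
    the past next to the new observation.\<close>
  also have "\<dots> = pair (snd_proj C (tensO_upto C X r) (X t)) (obs_kernel r \<otimes> g t)"
    using Suc by (simp add: tens_eq_pair[of "obs_kernel r"] pair_cmp_deterministic)
  finally show ?thesis
    using Suc by (simp add: last_proj_def)
qed

lemma state_obs_proj_simps:
  assumes "t \<le> n"
  shows "state_obs_proj C X Y t \<in> Arr C" "Dom C (state_obs_proj C X Y t) = tensO_upto C (\<lambda>s. X s \<boxtimes> Y s) t"
  using assms obs_proj_simps[of "t - 1"]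
  by (auto simp: state_obs_proj_def split: nat.split)

lemma state_obs_marginal_eq:
  assumes "t \<le> n"
  shows "state_obs_marginal C X Y (hmm C X f g n) n t = joint_state t"
  using assms emission_simps[OF assms] state_obs_proj_simps[OF assms] cmp_cmp_eq[OF state_obs_proj_emission[OF assms]]
  by (simp add: state_obs_marginal_def initial_proj_hmm joint_state_def hmm_def[of C X f g t])

section \<open>Disintegration by the Bayes filter, and one-step recursions\<close>

lemma obs_state_simps [simp]:
  assumes "t \<le> n"
  shows "obs_state t \<in> Arr C" "Dom C (obs_state t) = \<I>" "Cod C (obs_state t) = tensO_upto C Y t"
  using assms by (auto simp: obs_state_def)

lemma joint_state_simps [simp]:
  assumes "t \<le> n"
  shows "joint_state t \<in> Arr C" "Dom C (joint_state t) = \<I>" "Cod C (joint_state t) = X t \<boxtimes> tensO_upto C Y t"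
  using assms by (auto simp: joint_state_def)

lemma snd_joint_state:
  assumes "t \<le> n"
  shows "snd_proj C (X t) (tensO_upto C Y t) \<cdot> joint_state t = obs_state t"
  unfolding joint_state_def obs_state_def using assms
  by (intro cmp_cmp_eq) auto

lemma bayes_filter_joint_state:
  assumes "t \<le> n" "bayes_filter C X Y (hmm C X f g n) n t b"
  shows "b \<in> Arr C" "Dom C b = tensO_upto C Y t" "Cod C b = X t"
    "joint_state t = pair b (ide C (tensO_upto C Y t)) \<cdot> obs_state t"
proof -
  let ?Y = "tensO_upto C Y t"
  show b: "b \<in> Arr C" "Dom C b = ?Y" "Cod C b = X t"
    using assms(2) by (auto simp: bayes_filter_def hom_def)
  have "conditional C \<I> (X t) ?Y (joint_state t) (b \<cdot> lunit C ?Y)"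
    using assms by (simp add: bayes_filter_def state_obs_marginal_eq)
  then have "joint_state t = pair (b \<cdot> lunit C ?Y) (snd_proj C \<I> ?Y) \<cdot> pair (ide C \<I>) (obs_state t)"
    using assms(1) conditional_eq[of \<I> "X t" ?Y "joint_state t" "b \<cdot> lunit C ?Y"]
    by (simp add: snd_joint_state)
  \<comment> \<open>Deletion on \<open>\<I>\<close> is the identity, so the unitor is the projection
    off the unit factor.\<close>
  also have "pair (b \<cdot> lunit C ?Y) (snd_proj C \<I> ?Y) = pair b (ide C ?Y) \<cdot> snd_proj C \<I> ?Y"
    using b assms(1) del_unit by (simp add: pair_cmp_deterministic) (simp add: snd_proj_def)
  finally show "joint_state t = pair b (ide C ?Y) \<cdot> obs_state t"
    using b assms(1) by simp
qed

text \<open>The Markov property: \<open>f (Suc t)\<close> reads only the last state, so the joint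
  law at time \<open>t\<close> already suffices to generate the next one.\<close>

lemma joint_state_Suc:
  assumes "Suc t \<le> n"
  shows "joint_state (Suc t) = (inner_swap (tensO_upto C Y t) (X (Suc t)) (Y (Suc t))
    \<cdot> (ide C (tensO_upto C Y t) \<otimes> (pair (ide C (X (Suc t))) (g (Suc t)) \<cdot> f (Suc t)))
    \<cdot> swap C (X t) (tensO_upto C Y t)) \<cdot> joint_state t"
proof -
  let ?X = "tensO_upto C X t" and ?Y = "tensO_upto C Y t" and ?X' = "X (Suc t)" and ?Y' = "Y (Suc t)"
  let ?G = "obs_kernel t" and ?g = "g (Suc t)" and ?f = "f (Suc t)" and ?l = "last_proj X t"
  let ?W = "inner_swap ?Y ?X' ?Y'" and ?e = "pair (ide C ?X') ?g"
  have [simp]: "t \<le> n" "Suc t \<le> n"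
    using assms by auto
  have "pair (snd_proj C ?X ?X') (?G \<otimes> ?g) = ?W \<cdot> (?G \<otimes> ?e)"
    by (simp add: tens_eq_pair[of ?G] pair_cmp_deterministic)
  then have "joint_state (Suc t) = (?W \<cdot> (?G \<otimes> ?e)) \<cdot> pair (ide C ?X) (?f \<cdot> ?l) \<cdot> state_chain t"
    unfolding joint_state_def using assms by (subst state_chain_Suc) (auto simp: last_proj_def)
  also have "\<dots> = ?W \<cdot> ((?G \<otimes> ?e) \<cdot> pair (ide C ?X) (?f \<cdot> ?l)) \<cdot> state_chain t"
    by (simp del: tens_pair)
  also have "(?G \<otimes> ?e) \<cdot> pair (ide C ?X) (?f \<cdot> ?l) =
      (ide C ?Y \<otimes> (?e \<cdot> ?f)) \<cdot> swap C (X t) ?Y \<cdot> pair ?l ?G"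
    by simp
  finally show ?thesis
    by (simp add: joint_state_def del: tens_pair swap_pair)
qed

lemma obs_state_Suc:
  assumes "Suc t \<le> n"
  shows "obs_state (Suc t) = ((ide C (tensO_upto C Y t) \<otimes> (g (Suc t) \<cdot> f (Suc t)))
    \<cdot> swap C (X t) (tensO_upto C Y t)) \<cdot> joint_state t"
proof -
  let ?X = "tensO_upto C X t" and ?Y = "tensO_upto C Y t"
  let ?G = "obs_kernel t" and ?g = "g (Suc t)" and ?f = "f (Suc t)" and ?l = "last_proj X t"
  have [simp]: "t \<le> n" "Suc t \<le> n"
    using assms by auto
  have "obs_state (Suc t) = (?G \<otimes> ?g) \<cdot> pair (ide C ?X) (?f \<cdot> ?l) \<cdot> state_chain t"
    unfolding obs_state_def using assms by (subst state_chain_Suc) auto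
  also have "\<dots> = ((?G \<otimes> ?g) \<cdot> pair (ide C ?X) (?f \<cdot> ?l)) \<cdot> state_chain t"
    by (subst cmp_assoc_right) auto
  also have "(?G \<otimes> ?g) \<cdot> pair (ide C ?X) (?f \<cdot> ?l) =
      (ide C ?Y \<otimes> (?g \<cdot> ?f)) \<cdot> swap C (X t) ?Y \<cdot> pair ?l ?G"
    by simp
  finally show ?thesis
    by (simp add: joint_state_def del: tens_pair swap_pair)
qed

text \<open>Substituting the disintegration by \<open>b\<close> replaces the hidden state with a
  function of the past observations, so both laws become images of
  \<open>obs_state t\<close>.\<close>

lemma bayes_filter_Suc:
  assumes t: "Suc t \<le> n"
    and b: "b \<in> Arr C" "Dom C b = tensO_upto C Y t" "Cod C b = X t"
    and joint: "joint_state t = pair b (ide C (tensO_upto C Y t)) \<cdot> obs_state t"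
  shows "joint_state (Suc t) = inner_swap (tensO_upto C Y t) (X (Suc t)) (Y (Suc t))
      \<cdot> pair (ide C (tensO_upto C Y t)) (pair (ide C (X (Suc t))) (g (Suc t)) \<cdot> f (Suc t) \<cdot> b) \<cdot> obs_state t"
    and "obs_state (Suc t) = pair (ide C (tensO_upto C Y t)) (g (Suc t) \<cdot> f (Suc t) \<cdot> b) \<cdot> obs_state t"
proof -
  let ?Y = "tensO_upto C Y t" and ?g = "g (Suc t)" and ?f = "f (Suc t)"
  let ?e = "pair (ide C (X (Suc t))) ?g" and ?W = "inner_swap ?Y (X (Suc t)) (Y (Suc t))"
  have [simp]: "t \<le> n" "Suc t \<le> n"
    using assms by auto
  note [simp] = b
  have "joint_state (Suc t) =
      ?W \<cdot> ((ide C ?Y \<otimes> (?e \<cdot> ?f)) \<cdot> swap C (X t) ?Y \<cdot> pair b (ide C ?Y)) \<cdot> obs_state t"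
    unfolding joint_state_Suc[OF t] joint by (simp del: tens_pair swap_pair)
  then show "joint_state (Suc t) = ?W \<cdot> pair (ide C ?Y) (?e \<cdot> ?f \<cdot> b) \<cdot> obs_state t"
    by simp
  have "obs_state (Suc t) =
      ((ide C ?Y \<otimes> (?g \<cdot> ?f)) \<cdot> swap C (X t) ?Y \<cdot> pair b (ide C ?Y)) \<cdot> obs_state t"
    unfolding obs_state_Suc[OF t] joint by (simp del: tens_pair swap_pair)
  then show "obs_state (Suc t) = pair (ide C ?Y) (?g \<cdot> ?f \<cdot> b) \<cdot> obs_state t"
    by simp
qed

end

section \<open>The filter process\<close>

locale bayes_filtering = hidden_markov_model C X Y f g n
  for C :: "('o, 'm, 'z) mcat_scheme" (structure) and X Y f g n +
  fixes P :: "'o \<Rightarrow> 'o" and samp :: "'o \<Rightarrow> 'm" and BF u :: "nat \<Rightarrow> 'm"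
  assumes compat: "as_compatibly_representable_by C P samp"
    and filters: "bayes_filters C X Y (hmm C X f g n) n BF"
    and updates: "update_maps C P samp X Y f g n BF u"
begin

section \<open>Recursion for the Bayes filter and its counterpart\<close>

lemma representable: "representable_by C P samp"
  using compat by (simp add: as_compatibly_representable_by_def)

lemma samp_simps [simp]:
  assumes "t \<le> n"
  shows "P (X t) \<in> Obj C" "samp (X t) \<in> Arr C" "Dom C (samp (X t)) = P (X t)" "Cod C (samp (X t)) = X t"
  using representable assms by (auto simp: representable_by_def hom_def)

lemma BF_simps [simp]:
  assumes "t \<le> n"
  shows "BF t \<in> Arr C" "Dom C (BF t) = tensO_upto C Y t" "Cod C (BF t) = X t"
  using bayes_filter_joint_state(1-3)[of t "BF t"] filters assms by (auto simp: bayes_filters_def)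

lemma joint_state_BF:
  assumes "t \<le> n"
  shows "joint_state t = pair (BF t) (ide C (tensO_upto C Y t)) \<cdot> obs_state t"
  using bayes_filter_joint_state(4)[of t "BF t"] filters assms by (auto simp: bayes_filters_def)

abbreviation BF_sharp :: "nat \<Rightarrow> 'm" where
  "BF_sharp t \<equiv> sharp C P samp (BF t)"

lemma BF_sharp_simps [simp]:
  assumes "t \<le> n"
  shows "BF_sharp t \<in> Arr C" "Dom C (BF_sharp t) = tensO_upto C Y t" "Cod C (BF_sharp t) = P (X t)"
    "deterministic C (BF_sharp t)" "samp (X t) \<cdot> BF_sharp t = BF t"
  using sharp_simps[OF representable, of "BF t"] assms by auto

text \<open>The observation marginal of the kernel conditioned by \<open>u (Suc t)\<close>.\<close>

definition predicted_obs :: "nat \<Rightarrow> 'm" where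
  "predicted_obs t = g (Suc t) \<cdot> f (Suc t) \<cdot> samp (X t)"

lemma predicted_obs_simps [simp]:
  assumes "Suc t \<le> n"
  shows "predicted_obs t \<in> Arr C" "Dom C (predicted_obs t) = P (X t)" "Cod C (predicted_obs t) = Y (Suc t)"
  using assms by (auto simp: predicted_obs_def)

lemma update_simps [simp]:
  assumes "Suc t \<le> n"
  shows "u (Suc t) \<in> Arr C" "Dom C (u (Suc t)) = P (X t) \<boxtimes> Y (Suc t)" "Cod C (u (Suc t)) = X (Suc t)"
  using updates assms by (auto simp: update_maps_def conditional_def hom_def)

lemma update_eq:
  assumes "Suc t \<le> n"
  shows "pair (ide C (X (Suc t))) (g (Suc t)) \<cdot> f (Suc t) \<cdot> samp (X t) =
    pair (u (Suc t)) (snd_proj C (P (X t)) (Y (Suc t))) \<cdot> pair (ide C (P (X t))) (predicted_obs t)"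
proof -
  let ?k = "pair (ide C (X (Suc t))) (g (Suc t)) \<cdot> f (Suc t) \<cdot> samp (X t)"
  have "(ide C (X (Suc t)) \<otimes> g (Suc t)) \<cdot> copy C (X (Suc t)) \<cdot> f (Suc t) \<cdot> samp (X t) = ?k"
    using assms by (simp add: pair_def)
  then have "conditional C (P (X t)) (X (Suc t)) (Y (Suc t)) ?k (u (Suc t))"
    using updates assms by (auto simp: update_maps_def Suc_le_eq)
  moreover have "snd_proj C (X (Suc t)) (Y (Suc t)) \<cdot> ?k = predicted_obs t"
    unfolding predicted_obs_def using assms by (intro cmp_cmp_eq) auto
  ultimately show ?thesis
    using assms conditional_eq[of "P (X t)" "X (Suc t)" "Y (Suc t)" ?k "u (Suc t)"] by simp
qed

lemma obs_state_Suc_predicted: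
  assumes "Suc t \<le> n"
  shows "obs_state (Suc t) = pair (ide C (tensO_upto C Y t)) (predicted_obs t \<cdot> BF_sharp t) \<cdot> obs_state t"
  using bayes_filter_Suc(2)[OF assms, of "BF t"] assms joint_state_BF[of t]
  by (simp add: predicted_obs_def)

text \<open>\<open>BF_sharp t \<otimes> id\<close> in pair form: the previous filter value together
  with the new observation.\<close>

definition recursive_input :: "nat \<Rightarrow> 'm" where
  "recursive_input t = pair (BF_sharp t \<cdot> fst_proj C (tensO_upto C Y t) (Y (Suc t)))
     (snd_proj C (tensO_upto C Y t) (Y (Suc t)))"

lemma recursive_input_simps [simp]:
  assumes "Suc t \<le> n"
  shows "recursive_input t \<in> Arr C" "Dom C (recursive_input t) = tensO_upto C Y t \<boxtimes> Y (Suc t)"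
    "Cod C (recursive_input t) = P (X t) \<boxtimes> Y (Suc t)" "deterministic C (recursive_input t)"
  unfolding recursive_input_def using assms
  by (auto intro!: deterministic_pair deterministic_cmp)

text \<open>Both morphisms disintegrate \<open>joint_state (Suc t)\<close> over the same observation
  law.\<close>

lemma BF_recursion:
  assumes "Suc t \<le> n"
  shows "as_equal C (obs_state (Suc t)) (BF (Suc t)) (u (Suc t) \<cdot> recursive_input t)"
proof -
  let ?Y = "tensO_upto C Y t" and ?X' = "X (Suc t)" and ?Y' = "Y (Suc t)"
  let ?k = "pair (ide C ?X') (g (Suc t)) \<cdot> f (Suc t) \<cdot> samp (X t)" and ?W = "inner_swap ?Y ?X' ?Y'"
  let ?v = "u (Suc t) \<cdot> recursive_input t" and ?R = "obs_state (Suc t)"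
  have [simp]: "t \<le> n" "Suc t \<le> n"
    using assms by auto
  \<comment> \<open>Factoring \<open>BF t\<close> as sampling after \<open>BF_sharp t\<close>
    exposes the kernel \<open>?k\<close> of which \<open>u (Suc t)\<close> is a conditional.\<close>
  have "joint_state (Suc t) = ?W \<cdot> pair (ide C ?Y) (?k \<cdot> BF_sharp t) \<cdot> obs_state t"
    using bayes_filter_Suc(1)[OF assms, of "BF t"] joint_state_BF[of t] by simp
  also have "\<dots> = (?W \<cdot> pair (ide C ?Y) (?k \<cdot> BF_sharp t)) \<cdot> obs_state t"
    by (subst cmp_assoc_right) auto
  also have "?W \<cdot> pair (ide C ?Y) (?k \<cdot> BF_sharp t) =
      pair ?v (ide C (?Y \<boxtimes> ?Y')) \<cdot> pair (ide C ?Y) (predicted_obs t \<cdot> BF_sharp t)"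
    unfolding recursive_input_def
    by (rule conditional_after_deterministic[OF update_eq]) auto
  also have "\<dots> \<cdot> obs_state t = pair ?v (ide C (?Y \<boxtimes> ?Y')) \<cdot> ?R"
    unfolding obs_state_Suc_predicted[OF assms] by (subst cmp_assoc_right) auto
  finally have *: "pair (BF (Suc t)) (ide C (?Y \<boxtimes> ?Y')) \<cdot> ?R = pair ?v (ide C (?Y \<boxtimes> ?Y')) \<cdot> ?R"
    by (simp add: joint_state_BF)
  \<comment> \<open>The joint law lists the observations second, almost sure equality lists them
    first; a swap reconciles the two.\<close>
  have "pair (ide C (?Y \<boxtimes> ?Y')) a \<cdot> ?R = swap C ?X' (?Y \<boxtimes> ?Y') \<cdot> (pair a (ide C (?Y \<boxtimes> ?Y')) \<cdot> ?R)"
    if "a \<in> Arr C" "Dom C a = ?Y \<boxtimes> ?Y'" "Cod C a = ?X'" for a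
    by (rule cmp_cmp_eq[symmetric]) (use that in auto)
  then have "pair (ide C (?Y \<boxtimes> ?Y')) (BF (Suc t)) \<cdot> ?R = pair (ide C (?Y \<boxtimes> ?Y')) ?v \<cdot> ?R"
    using * by simp
  then show ?thesis
    by (simp add: as_equal_iff_pair)
qed

text \<open>Here a.s.-compatibility enters; determinism of \<open>recursive_input t\<close> then
  lets \<open>sharp\<close> act on the update map alone.\<close>

lemma BF_sharp_recursion:
  assumes "Suc t \<le> n"
  shows "as_equal C (obs_state (Suc t)) (BF_sharp (Suc t)) (sharp C P samp (u (Suc t)) \<cdot> recursive_input t)"
proof -
  let ?Y = "tensO_upto C Y (Suc t)" and ?v = "u (Suc t) \<cdot> recursive_input t"
  have "obs_state (Suc t) \<in> hom C \<I> ?Y" "BF (Suc t) \<in> hom C ?Y (X (Suc t))" "?v \<in> hom C ?Y (X (Suc t))"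
    "?Y \<in> Obj C" "X (Suc t) \<in> Obj C"
    using assms by (auto simp: hom_def)
  then have "as_equal C (obs_state (Suc t)) (BF_sharp (Suc t)) (sharp C P samp ?v)"
    using compat BF_recursion[OF assms] unitO_Obj unfolding as_compatibly_representable_by_def by blast
  then show ?thesis
    using assms by (simp add: sharp_cmp[OF representable])
qed

section \<open>The filter process as a Markov chain\<close>

lemma filter_kernel_Suc:
  assumes "Suc t \<le> n" "filter_kernel C P samp Y BF t \<in> Arr C"
    "Dom C (filter_kernel C P samp Y BF t) = tensO_upto C Y t"
  shows "filter_kernel C P samp Y BF (Suc t) =
    pair (filter_kernel C P samp Y BF t \<cdot> fst_proj C (tensO_upto C Y t) (Y (Suc t))) (BF_sharp (Suc t))"
proof -
  let ?Y = "tensO_upto C Y t"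
  have [simp]: "t \<le> n" "Suc t \<le> n"
    using assms by auto
  \<comment> \<open>One copy of the past goes to the earlier kernel, the other joins the new
    observation as input of \<open>BF_sharp (Suc t)\<close>.\<close>
  have "assoc C ?Y ?Y (Y (Suc t)) \<cdot> (copy C ?Y \<otimes> ide C (Y (Suc t))) =
      pair (fst_proj C ?Y (Y (Suc t))) (ide C (?Y \<boxtimes> Y (Suc t)))"
    using assoc_graph_tens[of "ide C ?Y" ?Y ?Y "Y (Suc t)"] by (simp add: pair_ide)
  then show ?thesis
    using assms(2,3) by simp
qed

lemma filter_kernel_simps [simp]:
  assumes "t \<le> n"
  shows "filter_kernel C P samp Y BF t \<in> Arr C"
    "Dom C (filter_kernel C P samp Y BF t) = tensO_upto C Y t"
    "Cod C (filter_kernel C P samp Y BF t) = tensO_upto C (\<lambda>s. P (X s)) t"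
    "deterministic C (filter_kernel C P samp Y BF t)"
proof -
  have "filter_kernel C P samp Y BF t \<in> Arr C \<and>
    Dom C (filter_kernel C P samp Y BF t) = tensO_upto C Y t \<and>
    Cod C (filter_kernel C P samp Y BF t) = tensO_upto C (\<lambda>s. P (X s)) t \<and>
    deterministic C (filter_kernel C P samp Y BF t)"
    using assms
  proof (induction t)
    case (Suc t)
    then have "filter_kernel C P samp Y BF (Suc t) =
        pair (filter_kernel C P samp Y BF t \<cdot> fst_proj C (tensO_upto C Y t) (Y (Suc t))) (BF_sharp (Suc t))"
      by (intro filter_kernel_Suc) auto
    with Suc show ?case
      by (auto simp del: filter_kernel.simps intro!: deterministic_pair deterministic_cmp)
  qed simp
  then show "filter_kernel C P samp Y BF t \<in> Arr C"
    "Dom C (filter_kernel C P samp Y BF t) = tensO_upto C Y t"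
    "Cod C (filter_kernel C P samp Y BF t) = tensO_upto C (\<lambda>s. P (X s)) t"
    "deterministic C (filter_kernel C P samp Y BF t)"
    by auto
qed

text \<open>Shows that the chain step, reading the last factor of the filter process, reads the
  current filter value.\<close>

lemma last_filter_kernel:
  assumes "t \<le> n"
  shows "last_proj (\<lambda>s. P (X s)) t \<cdot> filter_kernel C P samp Y BF t = BF_sharp t"
proof (cases t)
  case (Suc r)
  then show ?thesis
    using assms by (simp add: last_proj_def filter_kernel_Suc del: filter_kernel.simps)
qed (use assms in \<open>simp add: last_proj_def\<close>)

abbreviation filter_transition :: "nat \<Rightarrow> 'm" where
  "filter_transition \<equiv> transition C P samp X f g u"

lemma update_sharp_simps [simp]:
  assumes "Suc t \<le> n"
  shows "sharp C P samp (u (Suc t)) \<in> Arr C" "Dom C (sharp C P samp (u (Suc t))) = P (X t) \<boxtimes> Y (Suc t)"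
    "Cod C (sharp C P samp (u (Suc t))) = P (X (Suc t))"
  using sharp_simps[OF representable, of "u (Suc t)"] assms by auto

lemma filter_transition_Suc:
  assumes "Suc t \<le> n"
  shows "filter_transition (Suc t) = sharp C P samp (u (Suc t)) \<cdot> pair (ide C (P (X t))) (predicted_obs t)"
  using assms by (simp add: pair_def predicted_obs_def)

lemma filter_process_step:
  assumes "Suc t \<le> n"
  shows "filter_kernel C P samp Y BF (Suc t) \<cdot> obs_state (Suc t) =
    chain_step C (\<lambda>s. P (X s)) t (filter_transition (Suc t)) \<cdot> filter_kernel C P samp Y BF t \<cdot> obs_state t"
proof -
  let ?Y = "tensO_upto C Y t" and ?Y' = "Y (Suc t)" and ?L = "filter_kernel C P samp Y BF t"
  let ?v = "sharp C P samp (u (Suc t))" and ?d = "BF_sharp t" and ?m = "predicted_obs t"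
  let ?fst = "fst_proj C ?Y ?Y'" and ?R = "obs_state (Suc t)" and ?PX = "\<lambda>s. P (X s)"
  let ?h = "filter_transition (Suc t)" and ?i = "ide C (?Y \<boxtimes> ?Y')"
  note [simp del] = filter_kernel.simps transition.simps
  have [simp]: "t \<le> n" "Suc t \<le> n"
    using assms by auto
  have PX: "?PX s \<in> Obj C" if "s \<le> t" for s
    using le_trans[OF that, of n] by simp
  have last: "last_proj ?PX t \<in> Arr C" "Dom C (last_proj ?PX t) = tensO_upto C ?PX t"
    "Cod C (last_proj ?PX t) = P (X t)" "tensO_upto C ?PX t \<in> Obj C"
    using last_proj_simps[of t ?PX, OF PX] tensO_upto_Obj[of t ?PX, OF PX] by auto
  have h: "?h \<in> Arr C" "Dom C ?h = P (X t)" "Cod C ?h = P (X (Suc t))"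
    by (auto simp: filter_transition_Suc)
  have "pair ?i (BF_sharp (Suc t)) \<cdot> ?R = pair ?i (?v \<cdot> recursive_input t) \<cdot> ?R"
    using BF_sharp_recursion[OF assms] by (simp add: as_equal_iff_pair)
  \<comment> \<open>Almost sure equality retains all observations; mapping that copy by the earlier
    filter kernel yields an equation between filter processes.\<close>
  then have "((?L \<cdot> ?fst) \<otimes> ide C (P (X (Suc t)))) \<cdot> (pair ?i (BF_sharp (Suc t)) \<cdot> ?R) =
      ((?L \<cdot> ?fst) \<otimes> ide C (P (X (Suc t)))) \<cdot> (pair ?i (?v \<cdot> recursive_input t) \<cdot> ?R)"
    by simp
  then have "filter_kernel C P samp Y BF (Suc t) \<cdot> ?R = pair (?L \<cdot> ?fst) (?v \<cdot> recursive_input t) \<cdot> ?R"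
    by (simp add: filter_kernel_Suc cmp_cmp_eq[OF tens_pair])
  also have "pair (?L \<cdot> ?fst) (?v \<cdot> recursive_input t) =
      (?L \<otimes> ?v) \<cdot> (assoc C ?Y (P (X t)) ?Y' \<cdot> (pair (ide C ?Y) ?d \<otimes> ide C ?Y'))"
    by (simp add: assoc_graph_tens recursive_input_def)
  also have "\<dots> \<cdot> ?R = ((?L \<otimes> ?v) \<cdot> (assoc C ?Y (P (X t)) ?Y' \<cdot>
      ((pair (ide C ?Y) ?d \<otimes> ide C ?Y') \<cdot> pair (ide C ?Y) (?m \<cdot> ?d)))) \<cdot> obs_state t"
    unfolding obs_state_Suc_predicted[OF assms] by (simp del: tens_pair)
  also have "\<dots> = pair ?L (?v \<cdot> pair ?d (?m \<cdot> ?d)) \<cdot> obs_state t"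
    by simp
  \<comment> \<open>The updated belief and the predicted observation use the same filter value, by
    determinism of \<open>?d\<close>.\<close>
  also have "pair ?d (?m \<cdot> ?d) = pair (ide C (P (X t))) ?m \<cdot> ?d"
    by (simp add: pair_cmp_deterministic)
  also have "pair ?L (?v \<cdot> pair (ide C (P (X t))) ?m \<cdot> ?d) = pair ?L (?h \<cdot> ?d)"
    by (simp add: filter_transition_Suc)
  \<comment> \<open>Determinism of \<open>?L\<close> pulls it out of the pair, with
    \<open>?d\<close> recovered as its last component.\<close>
  also have "\<dots> = pair (ide C (tensO_upto C ?PX t)) (?h \<cdot> last_proj ?PX t) \<cdot> ?L"
    using h last by (simp add: pair_cmp_deterministic last_filter_kernel)
  also have "\<dots> \<cdot> obs_state t = chain_step C ?PX t ?h \<cdot> ?L \<cdot> obs_state t"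
    using h last PX by (simp add: chain_step_eq homI)
  finally show ?thesis .
qed

lemma filter_process_markov:
  assumes "t \<le> n"
  shows "filter_process C P samp X Y (hmm C X f g n) n BF t = markov_chain C (\<lambda>s. P (X s)) filter_transition t"
proof -
  have "filter_kernel C P samp Y BF t \<cdot> obs_state t = markov_chain C (\<lambda>s. P (X s)) filter_transition t"
    using assms
  proof (induction t)
    \<comment> \<open>Both sides are the counterpart of \<open>BF 0\<close> after
      \<open>g 0 \<cdot> f 0\<close>, because \<open>u 0 = BF 0\<close>.\<close>
    case 0
    then show ?case
      using updates by (simp add: update_maps_def obs_state_def)
  next
    case (Suc t)
    then show ?case
      unfolding filter_process_step[OF Suc.prems] by simp
  qed
  then show ?thesis
    using assms by (simp add: filter_process_def obs_marginal_eq)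
qed

end

theorem theorem4p19:
  fixes C :: "('o, 'm, 'z) mcat_scheme"
    and P :: "'o \<Rightarrow> 'o" and samp :: "'o \<Rightarrow> 'm"
    and X Y :: "nat \<Rightarrow> 'o" and f g BF u h :: "nat \<Rightarrow> 'm" and p :: 'm and n :: nat
  assumes "markov_category C"
    and "has_conditionals C"
    and "as_compatibly_representable_by C P samp"
    and "hmm_kernels C X Y f g n"
    and "p = hmm C X f g n"
    and "bayes_filters C X Y p n BF"
    and "update_maps C P samp X Y f g n BF u"
    and "h = transition C P samp X f g u"
  shows "\<forall>t\<le>n. filter_process C P samp X Y p n BF t = markov_chain C (\<lambda>s. P (X s)) h t"
proof -
  interpret markov_category C
    by (fact assms(1))
  interpret bayes_filtering C X Y f g n P samp BF u
    using assms by unfold_locales auto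
  show ?thesis
    using filter_process_markov assms(5,8) by simp
qed

end
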